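(* Let $(G,q_1)$ and $(\Gamma,q_2)$ be metric groups with $|G|$ even, $|\Gamma|$ odd, $c:=\mathcal{G}(q_1)=-\mathcal{G}(q_2)$, $|\Gamma|=|G|-1$, and $K:=G_2=\{g\in G:2g=0\}\cong\mathbb{Z}_2\times\mathbb{Z}_2$. With $J$, $N'$, $\nu'_m$ as in the context, for all $m\in\mathbb{N}$, $(k,\varepsilon)\in J_1$, $g\in G_*$, $\gamma\in\Gamma_*$: $$\nu'_m(\pi)=|\mathcal{G}(q_1,m)+\mathcal{G}(q_2,m)|^2,$$ $$\nu'_m((k,\varepsilon))=\frac{|\mathcal{G}(q_1,m)+\mathcal{G}(q_2,m)|^2-\delta_{mk,0}\,q_1(k)^m}{2},$$ $$\nu'_m(g)=|\mathcal{G}(q_1,m)+\mathcal{G}(q_2,m)|^2-\delta_{mg,0}\,q_1(g)^m,$$ $$\nu'_m(\gamma)=|\mathcal{G}(q_1,m)+\mathcal{G}(q_2,m)|^2+\delta_{m\gamma,0}\,q_2(\gamma)^m.$$ In particular: (a) the condition (FS2), that for every $x\in J$ one has $\nu'_2(x)=0$ if $x\ne\overline x$ and $\nu'_2(x)\in\{1,-1\}$ if $x=\overline x$, is equivalent to $|\mathcal{G}(q_1,2)+\mathcal{G}(q_2,2)|^2=1$; (b) the condition (FS3), that for every $x\in J$ the number $\nu'_3(x)$ is a sum of $N'_{x,x,x}$ numbers belonging to $\{1,e^{2\pi i/3},e^{4\pi i/3}\}$, is equivalent to $|\mathcal{G}(q_1,3)+\mathcal{G}(q_2,3)|^2=4$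.
   Context: A metric group $(G,q)$ is a finite abelian group $G$ with a map $q:G\to\mathbb{T}=\{z\in\mathbb{C}:|z|=1\}$ such that $q(-g)=q(g)$ and $\langle g,h\rangle=q(g+h)q(g)^{-1}q(h)^{-1}$ is a non-degenerate bicharacter. $\mathcal{G}(q,m)=\frac{1}{\sqrt{|G|}}\sum_{g\in G}q(g)^m$, $\mathcal{G}(q)=\mathcal{G}(q,1)$. Let $a=1/\sqrt{|G|}$, $b=1/\sqrt{|\Gamma|}$. Fix $G_*\subset G$, $\Gamma_*\subset\Gamma$ with $G=K\sqcup G_*\sqcup(-G_* )$, $\Gamma=\{0\}\sqcup\Gamma_*\sqcup(-\Gamma_* )$. Let $J_1=(K\setminus\{0\})\times\{1,-1\}$ and $J=\{0,\pi\}\sqcup J_1\sqcup G_*\sqcup\Gamma_*$. Involution on $J$: $\overline{(k,\varepsilon)}=(k,c^2\langle k,k\rangle\varepsilon)$ for $(k,\varepsilon)\in J_1$ (here $c^2\in\{1,-1\}$), all other elements fixed. With blocks indexed in order by $\{0\},\{\pi\},J_1,G_*,\Gamma_*$ (rows $0,\pi,(k,\varepsilon),g,\gamma$; columns with primes): $$S'=\begin{pmatrix} \frac{-a+b}{2}&\frac{a+b}{2}&\frac{a}{2}&a&b\\ \frac{a+b}{2}&\frac{-a+b}{2}&\frac{-a}{2}&-a&b\\ \frac{a}{2}&\frac{-a}{2}&-\frac{a\langle k,k'\rangle+c\varepsilon\varepsilon'q_1(k)\delta_{k,k'}}{2}&-a\langle k,g'\rangle&0\\ a&-a&-a\langle g,k'\rangle&-a(\langle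 g,g'\rangle+\overline{\langle g,g'\rangle})&0\\ b&b&0&0&b(\langle\gamma,\gamma'\rangle+\overline{\langle\gamma,\gamma'\rangle}) \end{pmatrix},$$ $T'=\mathrm{Diag}(1,1,q_1(k),q_1(g),q_2(\gamma))$. Further $N'_{x,y,z}=\sum_{w\in J}S'_{w,x}S'_{w,y}S'_{w,z}/S'_{0,w}$, and $\nu'_m(z)=\sum_{x,y\in J}N'_{x,y,\overline z}\,S'_{0,x}S'_{0,y}(T'_{y,y}/T'_{x,x})^m$. *)

theory Defs
  imports Complex_Main "HOL-Library.Z2" "HOL-Library.Product_Plus" "HOL-Library.Multiset" "HOL-Library.Cardinality"
begin

definition pairing :: "('a::ab_group_add \<Rightarrow> complex) \<Rightarrow> 'a \<Rightarrow> 'a \<Rightarrow> complex" where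
  "pairing q g h = q (g + h) * inverse (q g) * inverse (q h)"

definition bicharacter :: "('a::ab_group_add \<Rightarrow> 'a \<Rightarrow> complex) \<Rightarrow> bool" where
  "bicharacter B \<longleftrightarrow>
     (\<forall>g h. cmod (B g h) = 1) \<and>
     (\<forall>g g' h. B (g + g') h = B g h * B g' h) \<and>
     (\<forall>g h h'. B g (h + h') = B g h * B g h')"

definition nondegenerate :: "('a::ab_group_add \<Rightarrow> 'a \<Rightarrow> complex) \<Rightarrow> bool" where
  "nondegenerate B \<longleftrightarrow>
     (\<forall>g. (\<forall>h. B g h = 1) \<longrightarrow> g = 0) \<and> (\<forall>h. (\<forall>g. B g h = 1) \<longrightarrow> h = 0)"

definition metric_group :: "('a::{finite, ab_group_add} \<Rightarrow> complex) \<Rightarrow> bool" where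
  "metric_group q \<longleftrightarrow>
     (\<forall>g. cmod (q g) = 1) \<and> (\<forall>g. q (- g) = q g) \<and>
     bicharacter (pairing q) \<and> nondegenerate (pairing q)"

definition gauss_sum :: "('a::finite \<Rightarrow> complex) \<Rightarrow> nat \<Rightarrow> complex" where
  "gauss_sum q m = 1 / of_real (sqrt (real CARD('a))) * (\<Sum>g\<in>UNIV. q g ^ m)"

definition nmult :: "nat \<Rightarrow> 'a::comm_monoid_add \<Rightarrow> 'a" where
  "nmult m g = (\<Sum>i<m. g)"

definition two_torsion :: "'a::ab_group_add set" where
  "two_torsion = {g. nmult 2 g = 0}"

text \<open>The type \<open>bit \<times> bit\<close> with componentwise addition is \<open>\<int>\<^sub>2 \<times> \<int>\<^sub>2\<close>.\<close>

definition iso_Z2_Z2 :: "'a::ab_group_add set \<Rightarrow> bool" where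
  "iso_Z2_Z2 K \<longleftrightarrow>
     (\<exists>f :: bit \<times> bit \<Rightarrow> 'a. (\<forall>x y. f (x + y) = f x + f y) \<and> bij_betw f UNIV K)"

definition splits_as :: "'a::ab_group_add set \<Rightarrow> 'a set \<Rightarrow> bool" where
  "splits_as K A \<longleftrightarrow>
     UNIV = K \<union> A \<union> uminus ` A \<and>
     K \<inter> A = {} \<and> K \<inter> uminus ` A = {} \<and> A \<inter> uminus ` A = {}"

text \<open>The sign of an index \<open>(k, \<epsilon>)\<close> is a complex number, because the involution multiplies it by
  the complex number \<open>c\<^sup>2 \<langle>k, k\<rangle>\<close>; the index set \<open>J\<close> below restricts it to \<open>{1, -1}\<close>.\<close>

datatype ('g, 'h) index = I0 | IPi | IK 'g complex | IG 'g | IGamma 'h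

definition J1 :: "('g::ab_group_add \<times> complex) set" where
  "J1 = (two_torsion - {0}) \<times> {1, -1}"

definition J :: "'g::ab_group_add set \<Rightarrow> 'h set \<Rightarrow> ('g, 'h) index set" where
  "J Gs \<Gamma>s = {I0, IPi} \<union> (\<lambda>(k, \<epsilon>). IK k \<epsilon>) ` J1 \<union> IG ` Gs \<union> IGamma ` \<Gamma>s"

fun bar :: "complex \<Rightarrow> ('g::ab_group_add \<Rightarrow> complex) \<Rightarrow> ('g, 'h) index \<Rightarrow> ('g, 'h) index" where
  "bar c q1 (IK k \<epsilon>) = IK k (c\<^sup>2 * pairing q1 k k * \<epsilon>)"
| "bar c q1 x = x"

fun S_entry :: "complex \<Rightarrow> complex \<Rightarrow> complex \<Rightarrow>
    ('g::ab_group_add \<Rightarrow> complex) \<Rightarrow> ('h::ab_group_add \<Rightarrow> complex) \<Rightarrow>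
    ('g, 'h) index \<Rightarrow> ('g, 'h) index \<Rightarrow> complex" where
  "S_entry a b c q1 q2 I0 I0 = (- a + b) / 2"
| "S_entry a b c q1 q2 I0 IPi = (a + b) / 2"
| "S_entry a b c q1 q2 I0 (IK k' \<epsilon>') = a / 2"
| "S_entry a b c q1 q2 I0 (IG g') = a"
| "S_entry a b c q1 q2 I0 (IGamma \<gamma>') = b"
| "S_entry a b c q1 q2 IPi I0 = (a + b) / 2"
| "S_entry a b c q1 q2 IPi IPi = (- a + b) / 2"
| "S_entry a b c q1 q2 IPi (IK k' \<epsilon>') = - a / 2"
| "S_entry a b c q1 q2 IPi (IG g') = - a"
| "S_entry a b c q1 q2 IPi (IGamma \<gamma>') = b"
| "S_entry a b c q1 q2 (IK k \<epsilon>) I0 = a / 2"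
| "S_entry a b c q1 q2 (IK k \<epsilon>) IPi = - a / 2"
| "S_entry a b c q1 q2 (IK k \<epsilon>) (IK k' \<epsilon>') =
     - ((a * pairing q1 k k' + c * \<epsilon> * \<epsilon>' * q1 k * of_bool (k = k')) / 2)"
| "S_entry a b c q1 q2 (IK k \<epsilon>) (IG g') = - a * pairing q1 k g'"
| "S_entry a b c q1 q2 (IK k \<epsilon>) (IGamma \<gamma>') = 0"
| "S_entry a b c q1 q2 (IG g) I0 = a"
| "S_entry a b c q1 q2 (IG g) IPi = - a"
| "S_entry a b c q1 q2 (IG g) (IK k' \<epsilon>') = - a * pairing q1 g k'"
| "S_entry a b c q1 q2 (IG g) (IG g') = - a * (pairing q1 g g' + cnj (pairing q1 g g'))"
| "S_entry a b c q1 q2 (IG g) (IGamma \<gamma>') = 0"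
| "S_entry a b c q1 q2 (IGamma \<gamma>) I0 = b"
| "S_entry a b c q1 q2 (IGamma \<gamma>) IPi = b"
| "S_entry a b c q1 q2 (IGamma \<gamma>) (IK k' \<epsilon>') = 0"
| "S_entry a b c q1 q2 (IGamma \<gamma>) (IG g') = 0"
| "S_entry a b c q1 q2 (IGamma \<gamma>) (IGamma \<gamma>') =
     b * (pairing q2 \<gamma> \<gamma>' + cnj (pairing q2 \<gamma> \<gamma>'))"

definition S_mat :: "complex \<Rightarrow>
    ('g::{finite, ab_group_add} \<Rightarrow> complex) \<Rightarrow> ('h::{finite, ab_group_add} \<Rightarrow> complex) \<Rightarrow>
    ('g, 'h) index \<Rightarrow> ('g, 'h) index \<Rightarrow> complex" where
  "S_mat c q1 q2 =
     S_entry (of_real (1 / sqrt (real CARD('g)))) (of_real (1 / sqrt (real CARD('h)))) c q1 q2"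

fun T_diag :: "('g \<Rightarrow> complex) \<Rightarrow> ('h \<Rightarrow> complex) \<Rightarrow> ('g, 'h) index \<Rightarrow> complex" where
  "T_diag q1 q2 I0 = 1"
| "T_diag q1 q2 IPi = 1"
| "T_diag q1 q2 (IK k \<epsilon>) = q1 k"
| "T_diag q1 q2 (IG g) = q1 g"
| "T_diag q1 q2 (IGamma \<gamma>) = q2 \<gamma>"

definition N_coeff :: "complex \<Rightarrow>
    ('g::{finite, ab_group_add} \<Rightarrow> complex) \<Rightarrow> ('h::{finite, ab_group_add} \<Rightarrow> complex) \<Rightarrow>
    'g set \<Rightarrow> 'h set \<Rightarrow>
    ('g, 'h) index \<Rightarrow> ('g, 'h) index \<Rightarrow> ('g, 'h) index \<Rightarrow> complex" where
  "N_coeff c q1 q2 Gs \<Gamma>s x y z =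
     (\<Sum>w\<in>J Gs \<Gamma>s.
        S_mat c q1 q2 w x * S_mat c q1 q2 w y * S_mat c q1 q2 w z / S_mat c q1 q2 I0 w)"

definition FS_indicator :: "complex \<Rightarrow>
    ('g::{finite, ab_group_add} \<Rightarrow> complex) \<Rightarrow> ('h::{finite, ab_group_add} \<Rightarrow> complex) \<Rightarrow>
    'g set \<Rightarrow> 'h set \<Rightarrow> nat \<Rightarrow> ('g, 'h) index \<Rightarrow> complex" where
  "FS_indicator c q1 q2 Gs \<Gamma>s m z =
     (\<Sum>x\<in>J Gs \<Gamma>s. \<Sum>y\<in>J Gs \<Gamma>s.
        N_coeff c q1 q2 Gs \<Gamma>s x y (bar c q1 z) * S_mat c q1 q2 I0 x * S_mat c q1 q2 I0 y *
        (T_diag q1 q2 y / T_diag q1 q2 x) ^ m)"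

definition FS2 :: "complex \<Rightarrow>
    ('g::{finite, ab_group_add} \<Rightarrow> complex) \<Rightarrow> ('h::{finite, ab_group_add} \<Rightarrow> complex) \<Rightarrow>
    'g set \<Rightarrow> 'h set \<Rightarrow> bool" where
  "FS2 c q1 q2 Gs \<Gamma>s \<longleftrightarrow>
     (\<forall>x\<in>J Gs \<Gamma>s.
        (x \<noteq> bar c q1 x \<longrightarrow> FS_indicator c q1 q2 Gs \<Gamma>s 2 x = 0) \<and>
        (x = bar c q1 x \<longrightarrow> FS_indicator c q1 q2 Gs \<Gamma>s 2 x \<in> {1, -1}))"

text \<open>The multiset \<open>M\<close> lists the summands with repetition; in particular the condition requires
  the complex number \<open>N'\<^sub>x\<^sub>x\<^sub>x\<close> to be a natural number.\<close>

definition FS3 :: "complex \<Rightarrow>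
    ('g::{finite, ab_group_add} \<Rightarrow> complex) \<Rightarrow> ('h::{finite, ab_group_add} \<Rightarrow> complex) \<Rightarrow>
    'g set \<Rightarrow> 'h set \<Rightarrow> bool" where
  "FS3 c q1 q2 Gs \<Gamma>s \<longleftrightarrow>
     (\<forall>x\<in>J Gs \<Gamma>s. \<exists>M :: complex multiset.
        of_nat (size M) = N_coeff c q1 q2 Gs \<Gamma>s x x x \<and>
        set_mset M \<subseteq> {1, exp (2 * of_real pi * \<i> / 3), exp (4 * of_real pi * \<i> / 3)} \<and>
        FS_indicator c q1 q2 Gs \<Gamma>s 3 x = sum_mset M)"

end

theory Submission
  imports Defs "Jordan_Normal_Form.Schur_Decomposition"
begin

text \<open>
  Summing first over \<open>x\<close> and \<open>y\<close> turns the indicator into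
  \<open>\<Sum>\<^sub>w S'(w, z) / S'(0, w) P(w) P*(w)\<close> (with \<open>z\<close> up to the involution), where \<open>P(w) = \<Sum>\<^sub>y S'(w, y) S'(0, y) T'(y)\<^sup>m\<close> is,
  block by block, a Fourier transform of \<open>q\<^sub>1\<^sup>m\<close> or \<open>q\<^sub>2\<^sup>m\<close> and \<open>P*\<close> is its complex conjugate. A second
  Fourier transform of \<open>P P*\<close> is supported where \<open>m z = 0\<close>, which produces the delta terms; the
  remaining terms combine to \<open>|G(q\<^sub>1, m) + G(q\<^sub>2, m)|\<^sup>2\<close> because \<open>b\<^sup>2 - a\<^sup>2 = a\<^sup>2 b\<^sup>2\<close>.

  Since 4 divides \<open>|G|\<close>, the order of \<open>\<Gamma>\<close> is 3 modulo 4, and this forces \<open>c\<^sup>2 = -1\<close>: on \<open>J\<^sub>1\<close> the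
  involution is then trivial exactly when \<open>\<langle>k, k\<rangle> = -1\<close>, and \<open>N'(x, x, x) = 2\<close> for \<open>x = (k, \<epsilon>)\<close>. As
  the only real sums of two cube roots of unity are 2 and -1, and the square is non-negative, (FS3) at such an \<open>x\<close> alone gives the
  value 4.
\<close>

section \<open>Complex matrices of order four\<close>

lemma trace_mult_commute:
  fixes X Y :: "'a::comm_ring_1 mat"
  assumes "X \<in> carrier_mat n n" "Y \<in> carrier_mat n n"
  shows "(\<Sum>i<n. (X * Y) $$ (i, i)) = (\<Sum>i<n. (Y * X) $$ (i, i))"
proof -
  have "(\<Sum>i<n. (X * Y) $$ (i, i)) = (\<Sum>i<n. \<Sum>j<n. X $$ (i, j) * Y $$ (j, i))"
    using assms by (intro sum.cong refl) (auto simp: scalar_prod_def lessThan_atLeast0 intro!: sum.cong)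
  also have "\<dots> = (\<Sum>j<n. \<Sum>i<n. Y $$ (j, i) * X $$ (i, j))"
    by (subst sum.swap) (simp add: mult.commute)
  also have "\<dots> = (\<Sum>i<n. (Y * X) $$ (i, i))"
    using assms by (intro sum.cong refl) (auto simp: scalar_prod_def lessThan_atLeast0 intro!: sum.cong)
  finally show ?thesis .
qed

lemma upper_triangular_mult:
  fixes X Y :: "'a::comm_ring_1 mat"
  assumes X: "X \<in> carrier_mat n n" "upper_triangular X"
    and Y: "Y \<in> carrier_mat n n" "upper_triangular Y"
  shows "upper_triangular (X * Y)"
    and "i < n \<Longrightarrow> (X * Y) $$ (i, i) = X $$ (i, i) * Y $$ (i, i)"
proof -
  have entry: "(X * Y) $$ (i, j) = (\<Sum>l<n. X $$ (i, l) * Y $$ (l, j))" if "i < n" "j < n" for i j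
    using X Y that by (auto simp: scalar_prod_def lessThan_atLeast0 intro!: sum.cong)
  have vanish: "X $$ (i, l) * Y $$ (l, j) = 0" if "i < n" "l < n" "l < i \<or> j < l" for i j l
    using X Y that upper_triangularD[of X l i] upper_triangularD[of Y j l] by auto
  show "upper_triangular (X * Y)"
  proof
    fix i j assume "j < i" "i < dim_row (X * Y)"
    then show "(X * Y) $$ (i, j) = 0"
      using X by (subst entry) (auto intro!: sum.neutral vanish)
  qed
  assume i: "i < n"
  then have "(X * Y) $$ (i, i) = (\<Sum>l\<in>{i}. X $$ (i, l) * Y $$ (l, i))"
    unfolding entry[OF i i]
    by (intro sum.mono_neutral_right) (auto intro!: vanish)
  then show "(X * Y) $$ (i, i) = X $$ (i, i) * Y $$ (i, i)" by simp
qed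

text \<open>Schur's decomposition writes \<open>A\<close> as \<open>P * B * Q\<close> with
  \<open>B\<close> upper triangular and \<open>Q\<close> inverse to \<open>P\<close>; the
  \<open>d i\<close> are the diagonal entries of \<open>B\<close>. Traces are invariant under
  conjugation, and the diagonal of a product of triangular matrices is the product of the
  diagonals.\<close>

lemma fourth_root_of_identity_eigenvalues:
  fixes A :: "complex mat"
  assumes A: "A \<in> carrier_mat n n" and A4: "(A * A) * (A * A) = 1\<^sub>m n"
  obtains d :: "nat \<Rightarrow> complex"
  where "\<And>i. i < n \<Longrightarrow> d i ^ 4 = 1"
    and "(\<Sum>i<n. A $$ (i, i)) = (\<Sum>i<n. d i)"
    and "(\<Sum>i<n. (A * A) $$ (i, i)) = (\<Sum>i<n. (d i)\<^sup>2)"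
proof -
  obtain es where "char_poly A = (\<Prod>a\<leftarrow>es. [:- a, 1:])"
    using char_poly_factorized[OF A] by blast
  then obtain B where B: "B \<in> carrier_mat n n" "upper_triangular B" "similar_mat A B"
    using schur_decomposition_exists[OF A] by blast
  then obtain P Q where "similar_mat_wit A B P Q"
    unfolding similar_mat_def by blast
  note wit = similar_mat_witD2[OF A this]
  have PQ: "P \<in> carrier_mat n n" "Q \<in> carrier_mat n n" "P * Q = 1\<^sub>m n" "Q * P = 1\<^sub>m n"
    and APBQ: "A = P * B * Q"
    using wit by auto
  have cancel: "Q * (P * M) = M" if "M \<in> carrier_mat n n" for M
    using assoc_mult_mat[OF PQ(2,1) that] PQ that by simp
  note assoc = assoc_mult_mat[of _ n n _ n _ n]
  have AA: "A * A = P * (B * B) * Q"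
    unfolding APBQ using PQ(1,2) B by (simp add: assoc cancel)
  have conj_trace: "(\<Sum>i<n. (P * M * Q) $$ (i, i)) = (\<Sum>i<n. M $$ (i, i))"
    if M: "M \<in> carrier_mat n n" for M
  proof -
    have "(\<Sum>i<n. (P * M * Q) $$ (i, i)) = (\<Sum>i<n. (Q * (P * M)) $$ (i, i))"
      using PQ M by (intro trace_mult_commute) auto
    then show ?thesis using cancel[OF M] by simp
  qed
  have B4: "(B * B) * (B * B) = 1\<^sub>m n"
  proof -
    have "1\<^sub>m n = P * ((B * B) * (B * B)) * Q"
      unfolding A4[symmetric] AA using PQ(1,2) B by (simp add: assoc cancel)
    then have "Q * (1\<^sub>m n * P) = Q * (P * ((B * B) * (B * B)) * Q * P)" by simp
    then show ?thesis using PQ B by (simp add: assoc cancel)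
  qed
  have BB: "upper_triangular (B * B)" "B * B \<in> carrier_mat n n"
    and BBd: "\<And>i. i < n \<Longrightarrow> (B * B) $$ (i, i) = (B $$ (i, i))\<^sup>2"
    using upper_triangular_mult[OF B(1,2) B(1,2)] B by (auto simp: power2_eq_square)
  show thesis
  proof (rule that[of "\<lambda>i. B $$ (i, i)"])
    fix i assume i: "i < n"
    have "1 = ((B * B) * (B * B)) $$ (i, i)" unfolding B4 using i by simp
    also have "\<dots> = ((B $$ (i, i))\<^sup>2)\<^sup>2"
      using upper_triangular_mult(2)[OF BB(2,1) BB(2,1) i] BBd[OF i] by (simp add: power2_eq_square)
    finally show "B $$ (i, i) ^ 4 = 1" by simp
  next
    show "(\<Sum>i<n. A $$ (i, i)) = (\<Sum>i<n. B $$ (i, i))"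
      unfolding APBQ using conj_trace B by blast
    show "(\<Sum>i<n. (A * A) $$ (i, i)) = (\<Sum>i<n. (B $$ (i, i))\<^sup>2)"
      unfolding AA using conj_trace[OF BB(2)] BBd by simp
  qed
qed

lemma complex_fourth_root_of_unity:
  assumes "(z::complex) ^ 4 = 1"
  shows "z \<in> {1, -1, \<i>, -\<i>}"
proof -
  have "(z - 1) * (z + 1) * ((z - \<i>) * (z + \<i>)) = z ^ 4 - 1"
    by (simp add: algebra_simps power4_eq_xxxx)
  then show ?thesis using assms by (auto simp: add_eq_0_iff2)
qed

text \<open>A parity argument in the Gaussian integers. Write the sum as
  \<open>U + V * \<i>\<close>. The condition on the squares says that (n - 1) / 2 of the
  \<open>d i\<close> are \<i> or -\<i>. This number is odd, hence so is \<open>V\<close>, and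
  \<open>U\<^sup>2 + V\<^sup>2 = 1\<close> leaves only \<open>U = 0\<close> and
  \<open>V\<^sup>2 = 1\<close>.\<close>

lemma square_of_unit_sum_of_fourth_roots:
  fixes d :: "nat \<Rightarrow> complex"
  assumes d4: "\<And>i. i < n \<Longrightarrow> d i ^ 4 = 1" and n: "n mod 4 = 3"
    and unit: "cmod (\<Sum>i<n. d i) = 1" and sq: "(\<Sum>i<n. (d i)\<^sup>2) = 1"
  shows "(\<Sum>i<n. d i)\<^sup>2 = -1"
proof -
  define t where "t = (\<Sum>i<n. d i)"
  \<comment> \<open>Here \<open>v\<close> is 0, 1 or -1, and it is nonzero exactly when the square
    of \<open>d i\<close> is -1; the last conjunct records that \<open>v\<close> and
    \<open>v\<^sup>2\<close> have the same parity.\<close>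
  have "\<exists>u v :: int. d i = of_int u + of_int v * \<i> \<and> (d i)\<^sup>2 = of_int (1 - 2 * v\<^sup>2) \<and> even (v\<^sup>2 - v)" if i: "i < n" for i
  proof -
    consider "d i = 1" | "d i = -1" | "d i = \<i>" | "d i = -\<i>"
      using complex_fourth_root_of_unity[OF d4[OF i]] by auto
    then show ?thesis
    proof cases
      case 1 then show ?thesis by (intro exI[of _ 1] exI[of _ 0]) auto
    next
      case 2 then show ?thesis by (intro exI[of _ "-1"] exI[of _ 0]) auto
    next
      case 3 then show ?thesis by (intro exI[of _ 0] exI[of _ 1]) auto
    next
      case 4 then show ?thesis by (intro exI[of _ 0] exI[of _ "-1"]) auto
    qed
  qed
  then obtain u v :: "nat \<Rightarrow> int" where uv: "\<And>i. i < n \<Longrightarrow> d i = of_int (u i) + of_int (v i) * \<i>"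
    and v2: "\<And>i. i < n \<Longrightarrow> (d i)\<^sup>2 = of_int (1 - 2 * (v i)\<^sup>2)"
    and ev: "\<And>i. i < n \<Longrightarrow> even ((v i)\<^sup>2 - v i)"
    by metis
  define U V where "U = (\<Sum>i<n. u i)" and "V = (\<Sum>i<n. v i)"
  have t: "t = of_int U + of_int V * \<i>"
    unfolding t_def U_def V_def using uv by (simp add: sum.distrib sum_distrib_right)
  have "of_int (\<Sum>i<n. 1 - 2 * (v i)\<^sup>2) = (1::complex)"
    using sq v2 by simp
  then have "(\<Sum>i<n. 1 - 2 * (v i)\<^sup>2) = 1" using of_int_eq_1_iff by blast
  then have "int n - 2 * (\<Sum>i<n. (v i)\<^sup>2) = 1"
    by (simp add: sum_subtractf sum_distrib_left)
  moreover have "even ((\<Sum>i<n. (v i)\<^sup>2) - V)"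
    unfolding V_def sum_subtractf[symmetric] using ev by (intro dvd_sum) auto
  ultimately have "odd V" using n by presburger
  have "(cmod t)\<^sup>2 = (of_int U)\<^sup>2 + (of_int V)\<^sup>2"
    unfolding t by (simp add: cmod_power2)
  then have "real_of_int (U\<^sup>2 + V\<^sup>2) = 1" using unit t_def by simp
  then have UV: "U\<^sup>2 + V\<^sup>2 = 1" by linarith
  moreover have "V\<^sup>2 \<ge> 1" using \<open>odd V\<close> by (metis even_zero int_one_le_iff_zero_less zero_less_power2)
  ultimately have "U\<^sup>2 = 0" "V\<^sup>2 = 1" using zero_le_power2[of U] by linarith+
  then have "U = 0" "(of_int V :: complex)\<^sup>2 = 1"
    by (auto simp flip: of_int_power)
  then have "t\<^sup>2 = -1" unfolding t by (simp add: power_mult_distrib)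
  then show ?thesis by (simp add: t_def)
qed

section \<open>Metric groups and their Gauss sums\<close>

lemma nmult_0 [simp]: "nmult 0 g = 0"
  and nmult_Suc [simp]: "nmult (Suc m) g = nmult m g + g"
  by (simp_all add: nmult_def)

lemma nmult_2: "nmult 2 g = g + g"
  by (simp add: numeral_2_eq_2)

lemma nmult_3: "nmult 3 g = g + g + g"
  by (simp add: numeral_3_eq_3)

locale metric_grp =
  fixes q :: "'a::{finite, ab_group_add} \<Rightarrow> complex"
  assumes metric: "metric_group q"
begin

abbreviation B where "B \<equiv> pairing q"

lemma norm_q [simp]: "cmod (q g) = 1"
  and q_minus [simp]: "q (- g) = q g"
  and norm_B [simp]: "cmod (B g h) = 1"
  and B_add_left: "B (g + g') h = B g h * B g' h"
  and B_add_right: "B g (h + h') = B g h * B g h'"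
  using metric unfolding metric_group_def bicharacter_def by auto

lemma B_commute: "B g h = B h g"
  by (simp add: pairing_def add.commute mult_ac)

lemma q_nonzero [simp]: "q g \<noteq> 0"
  using norm_q[of g] by fastforce

lemma B_nonzero [simp]: "B g h \<noteq> 0"
  using norm_B[of g h] by fastforce

lemma q_cnj [simp]: "q g * cnj (q g) = 1"
  by (simp add: complex_norm_square[symmetric])

lemma B_cnj [simp]: "B g h * cnj (B g h) = 1"
  by (simp add: complex_norm_square[symmetric])

lemma inverse_q: "inverse (q g) = cnj (q g)"
  by (rule inverse_unique) simp

lemma q_add: "q (g + h) = q g * q h * B g h"
  by (simp add: pairing_def field_simps)

lemma B_zero_left [simp]: "B 0 h = 1"
  using B_add_left[of 0 0 h] by simp

lemma B_zero_right [simp]: "B h 0 = 1"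
  using B_zero_left by (simp add: B_commute)

lemma q_zero [simp]: "q 0 = 1"
  using q_add[of 0 0] by simp

lemma B_minus_left: "B (- g) h = cnj (B g h)"
proof -
  have "B g h * B (- g) h = 1"
    using B_add_left[of g "- g" h] by simp
  then show ?thesis
    using B_cnj[of g h] B_nonzero mult_left_cancel by metis
qed

lemma B_minus_right: "B g (- h) = cnj (B g h)"
  using B_minus_left by (simp add: B_commute)

text \<open>Expand \<open>q (g + - g) = 1\<close> by bilinearity.\<close>

lemma B_self: "B g g = (q g)\<^sup>2"
proof -
  have "(q g)\<^sup>2 * cnj (B g g) = 1"
    using q_add[of g "- g"] by (simp add: B_minus_right power2_eq_square)
  then have "(q g)\<^sup>2 * (B g g * cnj (B g g)) = B g g"
    by (metis mult.left_commute mult.right_neutral)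
  then show ?thesis by simp
qed

lemma B_nmult_left: "B (nmult m g) h = B g h ^ m"
  by (induction m) (simp_all add: B_add_left)

lemma q_nmult: "q (nmult m g) = q g ^ m\<^sup>2"
proof (induction m)
  case (Suc m)
  have "q (nmult (Suc m) g) = q g ^ m\<^sup>2 * q g * (q g)\<^sup>2 ^ m"
    by (simp add: q_add Suc B_nmult_left B_self)
  also have "\<dots> = q g ^ (m\<^sup>2 + 1 + 2 * m)"
    by (simp add: power_add power_mult)
  also have "m\<^sup>2 + 1 + 2 * m = (Suc m)\<^sup>2"
    by (simp add: power2_eq_square)
  finally show ?case .
qed simp

text \<open>The first claim is \<open>q 0 = 1\<close> read through \<open>q_nmult\<close>; the
  second holds because \<open>(q g)\<^sup>2 = B g g\<close>, whose power \<open>m\<close> is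
  \<open>B (nmult m g) g\<close>. Hence \<open>q g ^ m\<close> is a sign wherever a delta term is
  nonzero.\<close>

lemma q_power_torsion:
  assumes "nmult m g = 0"
  shows "q g ^ m\<^sup>2 = 1" and "(q g ^ m)\<^sup>2 = 1"
proof -
  show "q g ^ m\<^sup>2 = 1"
    using q_nmult[of m g] assms by simp
  have "(q g ^ m)\<^sup>2 = B g g ^ m"
    by (simp add: B_self power_mult[symmetric] mult.commute)
  then show "(q g ^ m)\<^sup>2 = 1"
    using B_nmult_left[of m g g] assms by simp
qed

text \<open>Both the square and the cube of \<open>q g ^ 3\<close> are 1. This reduces the delta
  terms of the third indicators to 0 or 1.\<close>

lemma q_power_three_torsion:
  assumes "nmult 3 g = 0"
  shows "q g ^ 3 = 1"
proof -
  have "q g ^ 3 = q g ^ 3 * (q g ^ 3)\<^sup>2"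
    using q_power_torsion(2)[OF assms] by simp
  also have "\<dots> = q g ^ 3\<^sup>2"
    by (simp flip: power_mult power_add)
  finally show ?thesis
    using q_power_torsion(1)[OF assms] by simp
qed

text \<open>Character orthogonality: for nonzero \<open>g\<close>, translating the summation
  variable by an \<open>h0\<close> with \<open>B h0 g \<noteq> 1\<close> multiplies the sum by
  \<open>B h0 g\<close>.\<close>

lemma sum_B: "(\<Sum>h\<in>UNIV. B h g) = of_bool (g = 0) * of_nat CARD('a)"
proof (cases "g = 0")
  case False
  then obtain h0 where h0: "B h0 g \<noteq> 1"
    using metric unfolding metric_group_def nondegenerate_def by blast
  have "(\<Sum>h\<in>UNIV. B h g) = (\<Sum>h\<in>UNIV. B (h + h0) g)"
    by (rule sum.reindex_bij_witness[of _ "\<lambda>h. h + h0" "\<lambda>h. h - h0"]) auto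
  also have "\<dots> = B h0 g * (\<Sum>h\<in>UNIV. B h g)"
    by (simp add: B_add_left sum_distrib_left mult.commute)
  finally show ?thesis using False h0 by simp
qed simp

section \<open>Fourier transforms on a metric group\<close>

definition fourier :: "('a \<Rightarrow> complex) \<Rightarrow> 'a \<Rightarrow> complex" where
  "fourier \<phi> g = (\<Sum>h\<in>UNIV. B g h * \<phi> h)"

lemma fourier_minus:
  assumes "\<And>h. \<phi> (- h) = \<phi> h"
  shows "fourier \<phi> (- g) = fourier \<phi> g"
  unfolding fourier_def
  by (rule sum.reindex_bij_witness[of _ uminus uminus])
    (auto simp: B_minus_left B_minus_right assms)

lemma fourier_cnj:
  assumes "\<And>h. \<phi> (- h) = \<phi> h"
  shows "fourier (\<lambda>h. cnj (\<phi> h)) g = cnj (fourier \<phi> g)"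
  unfolding fourier_def cnj_sum
  by (rule sum.reindex_bij_witness[of _ uminus uminus])
    (auto simp: B_minus_right assms)

lemma fourier_zero: "fourier (\<lambda>h. q h ^ m) 0 = of_real (sqrt (real CARD('a))) * gauss_sum q m"
  by (simp add: fourier_def gauss_sum_def)

definition energy :: "nat \<Rightarrow> 'a \<Rightarrow> complex" where
  "energy m g = fourier (\<lambda>h. q h ^ m) g * cnj (fourier (\<lambda>h. q h ^ m) g)"

lemma energy_minus: "energy m (- g) = energy m g"
  by (simp add: energy_def fourier_minus)

lemma energy_zero: "energy m 0 = of_nat CARD('a) * (gauss_sum q m * cnj (gauss_sum q m))"
proof -
  have "(of_real (sqrt (real CARD('a))) :: complex) * of_real (sqrt (real CARD('a))) = of_nat CARD('a)"
    by (simp flip: of_real_mult)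
  then show ?thesis
    unfolding energy_def fourier_zero by (simp add: algebra_simps)
qed

text \<open>The transform of a squared absolute value is an autocorrelation: orthogonality in
  \<open>h\<close> forces \<open>v = u + g\<close>. Then \<open>q (u + g) ^ m\<close> splits off the
  character \<open>B (nmult m g) u\<close>, whose sum over \<open>u\<close> vanishes unless
  \<open>nmult m g = 0\<close>.\<close>

lemma fourier_energy:
  "(\<Sum>h\<in>UNIV. B h g * energy m h) = (of_nat CARD('a))\<^sup>2 * (of_bool (nmult m g = 0) * q g ^ m)"
proof -
  have eq: "(\<Sum>h\<in>UNIV. B h (g + u - v)) = (if v = u + g then of_nat CARD('a) else 0)" for u v
    using sum_B[of "g + u - v"] by (auto simp: algebra_simps of_bool_def)
  have "(\<Sum>h\<in>UNIV. B h g * energy m h)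
    = (\<Sum>h\<in>UNIV. \<Sum>u\<in>UNIV. \<Sum>v\<in>UNIV. q u ^ m * cnj (q v ^ m) * B h (g + u - v))"
    unfolding energy_def fourier_def cnj_sum sum_product unfolding sum_distrib_left
    by (intro sum.cong refl)
      (simp add: B_add_right B_minus_right mult_ac diff_conv_add_uminus del: add_uminus_conv_diff)
  also have "\<dots> = (\<Sum>u\<in>UNIV. \<Sum>v\<in>UNIV. q u ^ m * cnj (q v ^ m) * (\<Sum>h\<in>UNIV. B h (g + u - v)))"
    unfolding sum_distrib_left by (subst sum.swap) (intro sum.cong refl sum.swap)
  also have "\<dots> = (\<Sum>u\<in>UNIV. of_nat CARD('a) * (q u ^ m * cnj (q (u + g) ^ m)))"
    unfolding eq by (intro sum.cong refl) (simp add: if_distrib[of "\<lambda>x. _ * x"] mult_ac cong: if_cong)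
  also have "\<dots> = (\<Sum>u\<in>UNIV. of_nat CARD('a) * (cnj (q g) ^ m * cnj (B (nmult m g) u)))"
  proof (intro sum.cong refl)
    fix u
    have "q u ^ m * cnj (q (u + g) ^ m) = (q u * cnj (q u)) ^ m * (cnj (q g) ^ m * cnj (B g u ^ m))"
      by (simp add: q_add power_mult_distrib mult_ac B_commute del: q_cnj)
    then show "of_nat CARD('a) * (q u ^ m * cnj (q (u + g) ^ m))
        = of_nat CARD('a) * (cnj (q g) ^ m * cnj (B (nmult m g) u))"
      by (simp add: B_nmult_left)
  qed
  also have "\<dots> = of_nat CARD('a) * (cnj (q g) ^ m * cnj (\<Sum>u\<in>UNIV. B u (nmult m g)))"
    by (simp add: sum_distrib_left B_commute)
  also have "\<dots> = (of_nat CARD('a))\<^sup>2 * (of_bool (nmult m g = 0) * cnj (q g ^ m))"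
    unfolding sum_B by (simp add: power2_eq_square mult_ac)
  \<comment> \<open>On the support of the delta \<open>q g ^ m\<close> is 1 or -1, so the
    conjugation has no effect.\<close>
  also have "of_bool (nmult m g = 0) * cnj (q g ^ m) = of_bool (nmult m g = 0) * q g ^ m"
    using q_power_torsion(2)[of m g] by (auto simp: power2_eq_1_iff simp del: complex_cnj_power)
  finally show ?thesis .
qed

text \<open>Completing the square gives \<open>B g h * q h = cnj (q g) * q (h + g)\<close>, so the
  transform of \<open>q\<close> has constant absolute value; \<open>fourier_energy\<close> at 0 with
  \<open>m = 1\<close> determines it.\<close>

lemma norm_gauss_sum: "cmod (gauss_sum q 1) = 1"
proof -
  define s where "s = fourier q 0"
  have "fourier q g = cnj (q g) * s" for g
  proof -
    have "fourier q g = (\<Sum>h\<in>UNIV. cnj (q g) * q (h + g))"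
      unfolding fourier_def
    proof (intro sum.cong refl)
      fix h
      have "cnj (q g) * q (h + g) = (q g * cnj (q g)) * (B g h * q h)"
        by (simp only: q_add B_commute[of h g] mult_ac)
      then show "B g h * q h = cnj (q g) * q (h + g)" by simp
    qed
    also have "\<dots> = cnj (q g) * (\<Sum>h\<in>UNIV. q (h + g))"
      by (simp add: sum_distrib_left)
    also have "(\<Sum>h\<in>UNIV. q (h + g)) = s"
      unfolding s_def fourier_def
      by (simp, rule sum.reindex_bij_witness[of _ "\<lambda>h. h - g" "\<lambda>h. h + g"]) auto
    finally show ?thesis .
  qed
  then have "energy 1 g = s * cnj s" for g
    using q_cnj[of g] by (simp add: energy_def algebra_simps)
  then have "of_nat CARD('a) * (s * cnj s) = (of_nat CARD('a))\<^sup>2"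
    using fourier_energy[of 0 1] by simp
  then have "s * cnj s = of_nat CARD('a)" by (simp add: power2_eq_square)
  then have "of_nat CARD('a) * (gauss_sum q 1 * cnj (gauss_sum q 1)) = of_nat CARD('a)"
    using energy_zero[of 1] by (simp add: energy_def s_def)
  then have "gauss_sum q 1 * cnj (gauss_sum q 1) = 1" by simp
  then have "(cmod (gauss_sum q 1))\<^sup>2 = 1"
    unfolding complex_norm_square[symmetric] by (simp flip: of_real_power)
  then show ?thesis
    using norm_ge_zero[of "gauss_sum q 1"] unfolding power2_eq_1_iff by linarith
qed

text \<open>The substitution \<open>(g, h) = (u + v, u - v)\<close> diagonalizes the form \<open>q(g) q(h)\<close>.\<close>

lemma gauss_sum_squared:
  assumes no2: "\<And>g::'a. g + g = 0 \<Longrightarrow> g = 0"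
  shows "(gauss_sum q 1)\<^sup>2 = (gauss_sum q 2)\<^sup>2"
proof -
  let ?f = "\<lambda>(u, v). (u + v, u - v) :: 'a \<times> 'a"
  have "inj ?f"
  proof (rule injI, clarify)
    fix u v u' v' :: 'a
    assume *: "u + v = u' + v'" "u - v = u' - v'"
    have "(u - u') + (u - u') = (u + v) + (u - v) - (u' + v') - (u' - v')"
      by (simp add: algebra_simps)
    then have "u = u'" using no2[of "u - u'"] * by simp
    then show "u = u' \<and> v = v'" using * by simp
  qed
  then have bij: "bij ?f" by (simp add: bij_def finite_UNIV_inj_surj)
  have "(\<Sum>g\<in>UNIV. q g)\<^sup>2 = (\<Sum>(g, h)\<in>UNIV. q g * q h)"
    by (simp add: power2_eq_square sum_product sum.cartesian_product UNIV_Times_UNIV)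
  also have "\<dots> = (\<Sum>p\<in>UNIV. case ?f p of (g, h) \<Rightarrow> q g * q h)"
    by (rule sum.reindex_bij_betw[OF bij, symmetric])
  also have "\<dots> = (\<Sum>(u, v)\<in>UNIV. (q u)\<^sup>2 * (q v)\<^sup>2)"
  proof (intro sum.cong refl)
    fix p :: "'a \<times> 'a"
    obtain u v where p: "p = (u, v)" by (cases p)
    have "q (u + v) * q (u - v) = (q u)\<^sup>2 * (q v)\<^sup>2 * (B u v * cnj (B u v))"
      using q_add[of u "- v"]
      by (simp add: q_add[of u v] B_minus_right power2_eq_square mult_ac del: B_cnj)
    then show "(case ?f p of (g, h) \<Rightarrow> q g * q h) = (case p of (u, v) \<Rightarrow> (q u)\<^sup>2 * (q v)\<^sup>2)"
      by (simp add: p)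
  qed
  also have "\<dots> = (\<Sum>g\<in>UNIV. (q g)\<^sup>2)\<^sup>2"
    by (simp add: power2_eq_square[of "\<Sum>g\<in>UNIV. _ g"] sum_product sum.cartesian_product UNIV_Times_UNIV)
  finally show ?thesis
    by (simp add: gauss_sum_def power_divide)
qed

text \<open>By \<open>gauss_sum_squared\<close> the Gauss sum is up to sign the trace of the unitary discrete Fourier
  transform, whose square is the permutation \<open>g \<mapsto> -g\<close>, of trace 1.\<close>

theorem gauss_sum_three_mod_four:
  assumes no2: "\<And>g::'a. g + g = 0 \<Longrightarrow> g = 0" and card3: "CARD('a) mod 4 = 3"
  shows "(gauss_sum q 1)\<^sup>2 = -1"
proof -
  obtain f :: "nat \<Rightarrow> 'a" where f: "bij_betw f {..<CARD('a)} UNIV"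
    using ex_bij_betw_nat_finite[of "UNIV :: 'a set"] by (auto simp: lessThan_atLeast0)
  have f_eq: "f i = f j \<longleftrightarrow> i = j" if "i < CARD('a)" "j < CARD('a)" for i j
    using f that by (auto simp: bij_betw_def inj_on_def)
  have reindex: "(\<Sum>i<CARD('a). \<phi> (f i)) = (\<Sum>g\<in>UNIV. \<phi> g)" for \<phi> :: "'a \<Rightarrow> complex"
    by (rule sum.reindex_bij_betw[OF f])
  define r :: complex where "r = of_real (1 / sqrt (real CARD('a)))"
  have r: "r * r * of_nat CARD('a) = 1"
  proof -
    have "1 / sqrt (real CARD('a)) * (1 / sqrt (real CARD('a))) * real CARD('a) = 1" by simp
    from arg_cong[OF this, of complex_of_real] show ?thesis
      by (simp only: r_def of_real_mult of_real_of_nat_eq of_real_1)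
  qed
  define A where "A = mat CARD('a) CARD('a) (\<lambda>(i, j). r * B (f i) (f j))"
  have A: "A \<in> carrier_mat CARD('a) CARD('a)" by (simp add: A_def)
  have AA: "A * A = mat CARD('a) CARD('a) (\<lambda>(i, j). of_bool (f i + f j = 0))"
  proof (rule eq_matI)
    fix i j assume "i < dim_row (mat CARD('a) CARD('a) (\<lambda>(i, j). of_bool (f i + f j = 0) :: complex))"
      and "j < dim_col (mat CARD('a) CARD('a) (\<lambda>(i, j). of_bool (f i + f j = 0) :: complex))"
    then have ij: "i < CARD('a)" "j < CARD('a)" by auto
    have "(A * A) $$ (i, j) = (\<Sum>l<CARD('a). r * r * B (f l) (f i + f j))"
      using ij by (simp add: A_def scalar_prod_def lessThan_atLeast0 B_add_right B_commute mult_ac)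
    also have "\<dots> = of_bool (f i + f j = 0) * (r * r * of_nat CARD('a))"
      unfolding reindex[of "\<lambda>g. r * r * B g (f i + f j)"] by (simp add: sum_distrib_left[symmetric] sum_B)
    finally show "(A * A) $$ (i, j) = mat CARD('a) CARD('a) (\<lambda>(i, j). of_bool (f i + f j = 0)) $$ (i, j)"
      unfolding r using ij by simp
  qed (simp_all add: A_def)
  have "(A * A) * (A * A) = 1\<^sub>m CARD('a)"
  proof (rule eq_matI)
    fix i j assume "i < dim_row (1\<^sub>m CARD('a) :: complex mat)" "j < dim_col (1\<^sub>m CARD('a) :: complex mat)"
    then have ij: "i < CARD('a)" "j < CARD('a)" by auto
    have "((A * A) * (A * A)) $$ (i, j)
        = (\<Sum>l<CARD('a). of_bool (f i + f l = 0) * of_bool (f l + f j = 0))"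
      using ij unfolding AA by (simp add: scalar_prod_def lessThan_atLeast0)
    also have "\<dots> = (\<Sum>g\<in>UNIV. of_bool (f i + g = 0) * of_bool (g + f j = 0))"
      by (rule reindex)
    also have "\<dots> = (\<Sum>g\<in>{- f i}. of_bool (f i + g = 0) * of_bool (g + f j = 0))"
      by (intro sum.mono_neutral_right) (auto simp: eq_neg_iff_add_eq_0 add.commute)
    also have "\<dots> = of_bool (f j = f i)"
      by (simp add: add_eq_0_iff)
    finally show "((A * A) * (A * A)) $$ (i, j) = 1\<^sub>m CARD('a) $$ (i, j)"
      using ij by (auto simp: f_eq)
  qed (simp_all add: A_def)
  then obtain d where d: "\<And>i. i < CARD('a) \<Longrightarrow> d i ^ 4 = 1"
    and trA: "(\<Sum>i<CARD('a). A $$ (i, i)) = (\<Sum>i<CARD('a). d i)"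
    and trAA: "(\<Sum>i<CARD('a). (A * A) $$ (i, i)) = (\<Sum>i<CARD('a). (d i)\<^sup>2)"
    using fourth_root_of_identity_eigenvalues[OF A] by blast
  \<comment> \<open>The diagonal entries involve \<open>B g g = (q g)\<^sup>2\<close>, which is why
    the trace is the Gauss sum with \<open>m = 2\<close>.\<close>
  have "(\<Sum>i<CARD('a). A $$ (i, i)) = (\<Sum>g\<in>UNIV. r * (q g)\<^sup>2)"
    using reindex[of "\<lambda>g. r * (q g)\<^sup>2"] by (simp add: A_def B_self)
  then have tr: "(\<Sum>i<CARD('a). d i) = gauss_sum q 2"
    unfolding trA[symmetric] by (simp add: gauss_sum_def r_def sum_divide_distrib)
  have "(\<Sum>i<CARD('a). (A * A) $$ (i, i)) = (\<Sum>i<CARD('a). of_bool (f i + f i = 0))"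
    by (simp add: AA)
  also have "\<dots> = (\<Sum>g\<in>(UNIV :: 'a set). of_bool (g + g = 0))"
    by (rule reindex[of "\<lambda>g. of_bool (g + g = 0)"])
  also have "\<dots> = (\<Sum>g\<in>{0 :: 'a}. of_bool (g + g = 0))"
    by (intro sum.mono_neutral_right) (auto dest: no2)
  finally have sq: "(\<Sum>i<CARD('a). (d i)\<^sup>2) = 1" using trAA by simp
  have "cmod (gauss_sum q 2) ^ 2 = 1"
    using gauss_sum_squared[OF no2] norm_gauss_sum by (metis norm_power power_one)
  then have "cmod (\<Sum>i<CARD('a). d i) = 1"
    using norm_ge_zero[of "gauss_sum q 2"] unfolding tr power2_eq_1_iff by linarith
  then have "(\<Sum>i<CARD('a). d i)\<^sup>2 = -1"
    using square_of_unit_sum_of_fourth_roots[of "CARD('a)" d] d card3 sq by blast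
  then show ?thesis unfolding tr using gauss_sum_squared[OF no2] by simp
qed

end

section \<open>The indicators\<close>

lemma sum_J:
  fixes f :: "('g::{finite, ab_group_add}, 'h::finite) index \<Rightarrow> complex"
  shows "(\<Sum>w\<in>J Gs \<Gamma>s. f w) = f I0 + f IPi
    + (\<Sum>k\<in>two_torsion - {0}. f (IK k 1) + f (IK k (- 1)))
    + (\<Sum>g\<in>Gs. f (IG g)) + (\<Sum>\<gamma>\<in>\<Gamma>s. f (IGamma \<gamma>))"
proof -
  have fin: "finite (J1 :: ('g \<times> complex) set)" "finite Gs" "finite \<Gamma>s"
    by (simp_all add: J1_def)
  have "(\<Sum>w\<in>(\<lambda>(k, \<epsilon>). IK k \<epsilon>) ` J1. f w) = (\<Sum>(k, \<epsilon>)\<in>J1. f (IK k \<epsilon>))"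
    by (subst sum.reindex) (auto simp: inj_on_def case_prod_unfold)
  also have "\<dots> = (\<Sum>k\<in>two_torsion - {0}. f (IK k 1) + f (IK k (- 1)))"
    unfolding J1_def by (subst sum.cartesian_product[symmetric]) simp
  finally have K: "(\<Sum>w\<in>(\<lambda>(k, \<epsilon>). IK k \<epsilon>) ` J1. f w)
    = (\<Sum>k\<in>two_torsion - {0}. f (IK k 1) + f (IK k (- 1)))" .
  let ?K = "(\<lambda>(k, \<epsilon>). IK k \<epsilon>) ` J1 :: ('g, 'h) index set"
  have "(\<Sum>w\<in>J Gs \<Gamma>s. f w) = (\<Sum>w\<in>{I0, IPi} \<union> ?K \<union> IG ` Gs. f w) + (\<Sum>w\<in>IGamma ` \<Gamma>s. f w)"
    unfolding J_def using fin by (intro sum.union_disjoint) auto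
  also have "(\<Sum>w\<in>{I0, IPi} \<union> ?K \<union> IG ` Gs. f w) = (\<Sum>w\<in>{I0, IPi} \<union> ?K. f w) + (\<Sum>w\<in>IG ` Gs. f w)"
    using fin by (intro sum.union_disjoint) auto
  also have "(\<Sum>w\<in>{I0, IPi} \<union> ?K. f w) = (\<Sum>w\<in>{I0, IPi}. f w) + (\<Sum>w\<in>?K. f w)"
    using fin by (intro sum.union_disjoint) auto
  finally show ?thesis
    unfolding K by (simp add: sum.reindex inj_on_def)
qed

lemma sum_splits_as:
  fixes \<phi> :: "'a::{finite, ab_group_add} \<Rightarrow> complex"
  assumes "splits_as K A"
  shows "(\<Sum>g\<in>UNIV. \<phi> g) = (\<Sum>g\<in>K. \<phi> g) + (\<Sum>g\<in>A. \<phi> g + \<phi> (- g))"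
proof -
  have "(\<Sum>g\<in>UNIV. \<phi> g) = (\<Sum>g\<in>K \<union> A \<union> uminus ` A. \<phi> g)"
    using assms by (simp add: splits_as_def)
  also have "\<dots> = (\<Sum>g\<in>K. \<phi> g) + (\<Sum>g\<in>A. \<phi> g) + (\<Sum>g\<in>uminus ` A. \<phi> g)"
    using assms unfolding splits_as_def
    by (subst sum.union_disjoint; (subst sum.union_disjoint)?) (auto simp: Int_Un_distrib2)
  also have "(\<Sum>g\<in>uminus ` A. \<phi> g) = (\<Sum>g\<in>A. \<phi> (- g))"
    by (simp add: sum.reindex)
  finally show ?thesis by (simp add: sum.distrib)
qed

text \<open>Every nonempty fibre of the doubling map is a coset of the 2-torsion subgroup, so it has
  four elements.\<close>

lemma four_dvd_card_of_two_torsion: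
  assumes "card (two_torsion :: 'a::{finite, ab_group_add} set) = 4"
  shows "4 dvd CARD('a)"
proof -
  let ?d = "\<lambda>g::'a. g + g"
  have "card (?d -` {y}) = 4" if "y \<in> range ?d" for y
  proof -
    from that obtain g0 where g0: "y = g0 + g0" by blast
    have "?d -` {y} = (\<lambda>k. g0 + k) ` two_torsion"
    proof (rule Set.set_eqI, rule iffI)
      fix g assume "g \<in> ?d -` {y}"
      then have "g - g0 \<in> two_torsion" by (simp add: two_torsion_def nmult_2 g0 algebra_simps)
      then show "g \<in> (\<lambda>k. g0 + k) ` two_torsion"
        by (intro image_eqI[of _ _ "g - g0"]) simp_all
    next
      fix g assume "g \<in> (\<lambda>k. g0 + k) ` two_torsion"
      then obtain k where k: "g = g0 + k" "k + k = 0"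
        by (auto simp: two_torsion_def nmult_2)
      have "g + g = g0 + g0 + (k + k)" using k(1) by (simp add: algebra_simps)
      then show "g \<in> ?d -` {y}" by (simp add: g0 k)
    qed
    then show ?thesis using assms by (simp add: card_image)
  qed
  moreover have "CARD('a) = (\<Sum>y\<in>range ?d. card (?d -` {y}))"
    using sum.image_gen[of "UNIV :: 'a set" "\<lambda>_. 1::nat" ?d] by (simp add: vimage_def)
  ultimately show ?thesis by simp
qed

text \<open>The coefficients of \<open>X\<close> and \<open>Y\<close> are the ratios \<open>S'(w, z) / S'(0, w)\<close> for \<open>w = 0\<close> and \<open>w = \<pi>\<close>, with
  \<open>z = \<pi>\<close>, \<open>g\<close>, \<open>\<gamma>\<close> in turn; the last summand on the left comes from the other blocks.\<close>

lemma gauss_combination: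
  fixes a b A A' C C' :: complex
  assumes ab: "b\<^sup>2 - a\<^sup>2 = a\<^sup>2 * b\<^sup>2" and nz: "a \<noteq> 0" "b \<noteq> 0"
  defines "X \<equiv> (a * A + b * C) * (a * A' + b * C') / 4"
    and "Y \<equiv> (b * C - a * A) * (b * C' - a * A') / 4"
  shows "(a + b) / (b - a) * X + (b - a) / (a + b) * Y
      + (a\<^sup>2 * (A * A') - b\<^sup>2 * (C * C')) / 2 = (A + C) * (A' + C')"
    and "2 * a / (b - a) * X - 2 * a / (a + b) * Y + a\<^sup>2 * (A * A') = (A + C) * (A' + C')"
    and "2 * b / (b - a) * X + 2 * b / (a + b) * Y - b\<^sup>2 * (C * C') = (A + C) * (A' + C')"
proof -
  have prod: "(b - a) * (a + b) = a\<^sup>2 * b\<^sup>2"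
    using ab by (simp add: algebra_simps power2_eq_square)
  then have "(b - a) * (a + b) \<noteq> 0" using nz by simp
  then have nz': "b - a \<noteq> 0" "a + b \<noteq> 0" by auto
  have inv: "1 / (b - a) = (a + b) / (a\<^sup>2 * b\<^sup>2)" "1 / (a + b) = (b - a) / (a\<^sup>2 * b\<^sup>2)"
    unfolding prod[symmetric] using nz' by simp_all
  \<comment> \<open>Since \<open>(b - a) * (a + b) = a\<^sup>2 * b\<^sup>2\<close>, all denominators
    can be replaced by \<open>a\<^sup>2 * b\<^sup>2\<close>.\<close>
  have div: "u / (b - a) = u * (a + b) / (a\<^sup>2 * b\<^sup>2)" "u / (a + b) = u * (b - a) / (a\<^sup>2 * b\<^sup>2)" for u
    using inv by (metis times_divide_eq_right mult.right_neutral)+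
  have [simp]: "a\<^sup>2 * b\<^sup>2 \<noteq> 0" using nz by simp
  \<comment> \<open>Over the common denominator the difference of the two sides is a multiple of
    \<open>b\<^sup>2 - a\<^sup>2 - a\<^sup>2 * b\<^sup>2\<close>, which is 0 by \<open>ab\<close>.
    The other two identities follow in the same way.\<close>
  have "(a + b) / (b - a) * X + (b - a) / (a + b) * Y
      + (a\<^sup>2 * (A * A') - b\<^sup>2 * (C * C')) / 2 - (A + C) * (A' + C')
    = (b\<^sup>2 - a\<^sup>2 - a\<^sup>2 * b\<^sup>2) * (b\<^sup>2 * (C * C') - a\<^sup>2 * (A * A')) / (2 * (a\<^sup>2 * b\<^sup>2))"
    unfolding div X_def Y_def by (simp add: divide_simps nz) (simp add: algebra_simps power2_eq_square power3_eq_cube)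
  then show "(a + b) / (b - a) * X + (b - a) / (a + b) * Y
      + (a\<^sup>2 * (A * A') - b\<^sup>2 * (C * C')) / 2 = (A + C) * (A' + C')"
    using ab by simp
  have "2 * a / (b - a) * X - 2 * a / (a + b) * Y + a\<^sup>2 * (A * A') - (A + C) * (A' + C')
      = (b\<^sup>2 - a\<^sup>2 - a\<^sup>2 * b\<^sup>2) * (- a\<^sup>2 * (A * A')) / (a\<^sup>2 * b\<^sup>2)"
    unfolding div X_def Y_def
    by (simp add: divide_simps nz) (simp add: algebra_simps power2_eq_square power3_eq_cube)
  then show "2 * a / (b - a) * X - 2 * a / (a + b) * Y + a\<^sup>2 * (A * A') = (A + C) * (A' + C')"
    using ab by simp
  have "2 * b / (b - a) * X + 2 * b / (a + b) * Y - b\<^sup>2 * (C * C') - (A + C) * (A' + C')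
      = (b\<^sup>2 - a\<^sup>2 - a\<^sup>2 * b\<^sup>2) * (b\<^sup>2 * (C * C')) / (a\<^sup>2 * b\<^sup>2)"
    unfolding div X_def Y_def
    by (simp add: divide_simps nz) (simp add: algebra_simps power2_eq_square power3_eq_cube)
  then show "2 * b / (b - a) * X + 2 * b / (a + b) * Y - b\<^sup>2 * (C * C') = (A + C) * (A' + C')"
    using ab by simp
qed

text \<open>The joint contributions of \<open>w = 0\<close> and \<open>w = \<pi>\<close> to \<open>N'(x, x, x)\<close> for \<open>x = \<pi>\<close>, \<open>g\<close>, \<open>\<gamma>\<close>.\<close>

lemma fusion_combination:
  fixes a b :: complex
  assumes ab: "b\<^sup>2 - a\<^sup>2 = a\<^sup>2 * b\<^sup>2" and nz: "a \<noteq> 0" "b \<noteq> 0"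
  shows "((a + b) / 2) ^ 3 / ((b - a) / 2) + ((b - a) / 2) ^ 3 / ((a + b) / 2) = 4 + (b\<^sup>2 - a\<^sup>2) / 2"
    and "a ^ 3 / ((b - a) / 2) - a ^ 3 / ((a + b) / 2) = 4 * (1 - a\<^sup>2)"
    and "b ^ 3 / ((b - a) / 2) + b ^ 3 / ((a + b) / 2) = 4 * (1 + b\<^sup>2)"
proof -
  have prod: "(b - a) * (a + b) = a\<^sup>2 * b\<^sup>2"
    using ab by (simp add: algebra_simps power2_eq_square)
  then have "(b - a) * (a + b) \<noteq> 0" using nz by simp
  then have nz': "b - a \<noteq> 0" "a + b \<noteq> 0" by auto
  have div: "u / ((b - a) / 2) = 2 * u * (a + b) / (a\<^sup>2 * b\<^sup>2)"
      "u / ((a + b) / 2) = 2 * u * (b - a) / (a\<^sup>2 * b\<^sup>2)" for u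
    unfolding prod[symmetric] using nz' by simp_all
  have "((a + b) / 2) ^ 3 / ((b - a) / 2) + ((b - a) / 2) ^ 3 / ((a + b) / 2) - (4 + (b\<^sup>2 - a\<^sup>2) / 2)
    = (b\<^sup>2 - a\<^sup>2) * (b\<^sup>2 - a\<^sup>2 - a\<^sup>2 * b\<^sup>2) / (2 * (a\<^sup>2 * b\<^sup>2))"
    unfolding div by (simp add: divide_simps nz) (simp add: algebra_simps power2_eq_square power3_eq_cube)
  then show "((a + b) / 2) ^ 3 / ((b - a) / 2) + ((b - a) / 2) ^ 3 / ((a + b) / 2) = 4 + (b\<^sup>2 - a\<^sup>2) / 2"
    using ab by simp
  have "a ^ 3 / ((b - a) / 2) - a ^ 3 / ((a + b) / 2) - 4 * (1 - a\<^sup>2)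
      = (b\<^sup>2 - a\<^sup>2 - a\<^sup>2 * b\<^sup>2) * (- 4 * a\<^sup>2) / (a\<^sup>2 * b\<^sup>2)"
    unfolding div
    by (simp add: divide_simps nz) (simp add: algebra_simps power2_eq_square power3_eq_cube)
  then show "a ^ 3 / ((b - a) / 2) - a ^ 3 / ((a + b) / 2) = 4 * (1 - a\<^sup>2)"
    using ab by simp
  have "b ^ 3 / ((b - a) / 2) + b ^ 3 / ((a + b) / 2) - 4 * (1 + b\<^sup>2)
      = (b\<^sup>2 - a\<^sup>2 - a\<^sup>2 * b\<^sup>2) * (4 * b\<^sup>2) / (a\<^sup>2 * b\<^sup>2)"
    unfolding div
    by (simp add: divide_simps nz) (simp add: algebra_simps power2_eq_square power3_eq_cube)
  then show "b ^ 3 / ((b - a) / 2) + b ^ 3 / ((a + b) / 2) = 4 * (1 + b\<^sup>2)"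
    using ab by simp
qed

text \<open>The imaginary parts cancel only in 1 + 1 and in the sum of the two conjugate primitive
  roots; the latter sum is -1.\<close>

lemma sum_of_two_cube_roots:
  fixes M :: "complex multiset"
  assumes "set_mset M \<subseteq> {1, exp (2 * of_real pi * \<i> / 3), exp (4 * of_real pi * \<i> / 3)}"
    and "size M = 2" and sum: "sum_mset M = of_real r" and "r \<ge> 0"
  shows "r = 2"
proof -
  have w: "exp (2 * of_real pi * \<i> / 3) = Complex (- 1 / 2) (sqrt 3 / 2)"
  proof -
    have "exp (2 * of_real pi * \<i> / 3) = cis (2 * pi / 3)"
      by (simp add: cis_conv_exp mult_ac)
    then show ?thesis by (simp add: cis.ctr cos_120 sin_120)
  qed
  have w2: "exp (4 * of_real pi * \<i> / 3) = Complex (- 1 / 2) (- sqrt 3 / 2)"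
  proof -
    have "exp (4 * of_real pi * \<i> / 3) = exp (2 * of_real pi * \<i> / 3) ^ 2"
      by (simp add: exp_double[symmetric] mult_ac)
    then show ?thesis unfolding w by (simp add: power2_eq_square complex_eq_iff)
  qed
  obtain x N where "M = add_mset x N" "size N = 1"
    using \<open>size M = 2\<close> size_eq_Suc_imp_eq_union[of M 1] by auto
  then obtain y where M: "M = {#x, y#}"
    using size_1_singleton_mset by blast
  have "x \<in> {1, Complex (- 1 / 2) (sqrt 3 / 2), Complex (- 1 / 2) (- sqrt 3 / 2)}"
    "y \<in> {1, Complex (- 1 / 2) (sqrt 3 / 2), Complex (- 1 / 2) (- sqrt 3 / 2)}"
    using assms(1) unfolding M w w2 by auto
  moreover have "Re x + Re y = r" "Im x + Im y = 0"
    using sum unfolding M by (auto simp: complex_eq_iff)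
  ultimately show ?thesis using \<open>r \<ge> 0\<close> by auto
qed

lemma half_ratio: "x / 2 / (y / 2) = x / y" for x y :: complex
  by (cases "y = 0"; simp add: field_simps)

lemma half_double: "2 * x / y * w / 2 = x / y * w" "- (2 * x / y * w) / 2 = - x / y * w" for x y w :: complex
  by simp_all

lemma half_cube: "(x / 2) ^ 3 / (y / 2) = x ^ 3 / (y / 2) / 8" for x y :: complex
  by (cases "y = 0"; simp add: power_divide)

lemma T_diag_power: "T_diag q1 q2 x ^ m = T_diag (\<lambda>g. q1 g ^ m) (\<lambda>h. q2 h ^ m) x"
  by (cases x) simp_all

section \<open>The common setting: the constants, the 2-torsion and folded sums\<close>

locale modular_data =
  G: metric_grp q1 + H: metric_grp q2
  for q1 :: "'g::{finite, ab_group_add} \<Rightarrow> complex"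
    and q2 :: "'h::{finite, ab_group_add} \<Rightarrow> complex" +
  fixes c :: complex and Gs :: "'g set" and \<Gamma>s :: "'h set"
  assumes c_eq: "c = - gauss_sum q2 1"
    and card_H: "CARD('h) = CARD('g) - 1"
    and iso: "iso_Z2_Z2 (two_torsion :: 'g set)"
    and splits_G: "splits_as two_torsion Gs"
    and splits_H: "splits_as {0} \<Gamma>s"
begin

abbreviation K :: "'g set" where "K \<equiv> two_torsion - {0}"

definition a :: complex where "a = of_real (1 / sqrt (real CARD('g)))"

definition b :: complex where "b = of_real (1 / sqrt (real CARD('h)))"

abbreviation S where "S \<equiv> S_entry a b c q1 q2"

lemma S_mat_eq: "S_mat c q1 q2 = S"
  by (simp add: S_mat_def a_def b_def)

lemma card_G: "CARD('g) = CARD('h) + 1"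
  using card_H by simp

lemma a_nonzero [simp]: "a \<noteq> 0" and b_nonzero [simp]: "b \<noteq> 0"
  by (simp_all add: a_def b_def)

lemma a_sqrt: "a * of_real (sqrt (real CARD('g))) = 1"
  and b_sqrt: "b * of_real (sqrt (real CARD('h))) = 1"
  by (simp_all add: a_def b_def)

lemma a_square: "a\<^sup>2 * of_nat CARD('g) = 1"
proof -
  have "a\<^sup>2 * of_real (real CARD('g)) = (a * of_real (sqrt (real CARD('g))))\<^sup>2"
    unfolding power_mult_distrib of_real_power[symmetric] by simp
  then show ?thesis unfolding a_sqrt by simp
qed

lemma b_square: "b\<^sup>2 * of_nat CARD('h) = 1"
proof -
  have "b\<^sup>2 * of_real (real CARD('h)) = (b * of_real (sqrt (real CARD('h))))\<^sup>2"
    unfolding power_mult_distrib of_real_power[symmetric] by simp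
  then show ?thesis unfolding b_sqrt by simp
qed

text \<open>This is |G| = |\<Gamma>| + 1 multiplied by \<open>a\<^sup>2 * b\<^sup>2\<close>.\<close>

lemma ab: "b\<^sup>2 - a\<^sup>2 = a\<^sup>2 * b\<^sup>2"
proof -
  have "(of_nat CARD('g) :: complex) = of_nat CARD('h) + 1"
    by (simp add: card_G)
  then have "b\<^sup>2 * (a\<^sup>2 * of_nat CARD('g)) = a\<^sup>2 * (b\<^sup>2 * of_nat CARD('h)) + a\<^sup>2 * b\<^sup>2"
    by (simp add: algebra_simps)
  then show ?thesis unfolding a_square b_square by (simp add: algebra_simps)
qed

lemma b_minus_a [simp]: "b - a \<noteq> 0" and a_plus_b [simp]: "a + b \<noteq> 0"
proof -
  have "(b - a) * (a + b) = a\<^sup>2 * b\<^sup>2"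
    using ab by (simp add: algebra_simps power2_eq_square)
  then have "(b - a) * (a + b) \<noteq> 0" by simp
  then show "b - a \<noteq> 0" "a + b \<noteq> 0" by auto
qed

lemma card_two_torsion: "card (two_torsion :: 'g set) = 4"
proof -
  obtain f :: "bit \<times> bit \<Rightarrow> 'g" where "bij_betw f UNIV two_torsion"
    using iso unfolding iso_Z2_Z2_def by blast
  then have "card (two_torsion :: 'g set) = CARD(bit \<times> bit)"
    using bij_betw_same_card by fastforce
  also have "CARD(bit \<times> bit) = 4"
  proof -
    have "(UNIV :: bit set) = {0, 1}" using bit_not_zero_iff by auto
    then have "CARD(bit) = card {0 :: bit, 1}" by (rule arg_cong)
    then have "CARD(bit) = 2" by simp
    then show ?thesis by simp
  qed
  finally show ?thesis .
qed

lemma zero_in_two_torsion: "(0 :: 'g) \<in> two_torsion"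
  by (simp add: two_torsion_def nmult_2)

lemma card_K: "card K = 3"
  using card_two_torsion zero_in_two_torsion by simp

lemma K_nonempty: "K \<noteq> {}"
  using card_K by force

lemma two_torsion_minus: "k \<in> two_torsion \<Longrightarrow> - k = k"
  by (simp add: two_torsion_def nmult_2 eq_neg_iff_add_eq_0[symmetric])

text \<open>As \<open>- k = k\<close>, the character of \<open>k\<close> equals its
  conjugate.\<close>

lemma B_K_minus: "k \<in> two_torsion \<Longrightarrow> cnj (G.B k g) = G.B k g"
  using G.B_minus_left[of k g] two_torsion_minus[of k] by simp

lemma B_K_square: "k \<in> two_torsion \<Longrightarrow> G.B k g * G.B k g = 1"
  using G.B_cnj[of k g] B_K_minus[of k g] by simp

lemma H_no_two_torsion: "g + g = 0 \<Longrightarrow> g = 0" for g :: 'h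
proof (rule ccontr)
  assume "g + g = 0" "g \<noteq> 0"
  then have "- g = g" by (simp add: eq_neg_iff_add_eq_0[symmetric])
  moreover have "g \<in> \<Gamma>s \<or> g \<in> uminus ` \<Gamma>s" "\<Gamma>s \<inter> uminus ` \<Gamma>s = {}"
    using splits_H \<open>g \<noteq> 0\<close> unfolding splits_as_def by auto
  ultimately show False by (metis IntI emptyE imageE image_eqI minus_minus)
qed

lemma c_square: "c\<^sup>2 = -1"
proof -
  obtain j where "CARD('g) = 4 * j"
    using four_dvd_card_of_two_torsion[OF card_two_torsion] by blast
  then have "CARD('h) mod 4 = 3" using card_G by presburger
  then show ?thesis
    using H.gauss_sum_three_mod_four[OF H_no_two_torsion] by (simp add: c_eq)
qed

text \<open>Evaluates a sum over \<open>J\<close> block by block. The two signs over one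
  \<open>k\<close> are added first, so that terms odd in the sign cancel there.\<close>

lemma sum_J_eqI:
  fixes f :: "('g, 'h) index \<Rightarrow> complex"
  assumes "f I0 = p" "f IPi = p'" "\<And>k. k \<in> K \<Longrightarrow> f (IK k 1) + f (IK k (- 1)) = r k"
    and "\<And>g. g \<in> Gs \<Longrightarrow> f (IG g) = s g" "\<And>\<gamma>. \<gamma> \<in> \<Gamma>s \<Longrightarrow> f (IGamma \<gamma>) = t \<gamma>"
  shows "(\<Sum>w\<in>J Gs \<Gamma>s. f w) = p + p' + (\<Sum>k\<in>K. r k) + (\<Sum>g\<in>Gs. s g) + (\<Sum>\<gamma>\<in>\<Gamma>s. t \<gamma>)"
  unfolding sum_J by (simp add: assms)

lemma sum_G: "(\<Sum>g\<in>UNIV. \<phi> g) = \<phi> 0 + (\<Sum>k\<in>K. \<phi> k) + (\<Sum>g\<in>Gs. \<phi> g + \<phi> (- g))"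
  for \<phi> :: "'g \<Rightarrow> complex"
  unfolding sum_splits_as[OF splits_G]
  using sum.remove[OF _ zero_in_two_torsion, of \<phi>] by simp

lemma sum_H: "(\<Sum>g\<in>UNIV. \<phi> g) = \<phi> 0 + (\<Sum>g\<in>\<Gamma>s. \<phi> g + \<phi> (- g))"
  for \<phi> :: "'h \<Rightarrow> complex"
  unfolding sum_splits_as[OF splits_H] by simp

section \<open>The indicator as a single sum over \<open>w\<close>\<close>

text \<open>This is P(w), stated for arbitrary \<open>\<phi>\<close> and \<open>\<psi>\<close> so
  that one computation also covers P*(w).\<close>

definition transform ::
    "('g \<Rightarrow> complex) \<Rightarrow> ('h \<Rightarrow> complex) \<Rightarrow> ('g, 'h) index \<Rightarrow> complex" where
  "transform \<phi> \<psi> w = (\<Sum>y\<in>J Gs \<Gamma>s. S w y * S I0 y * T_diag \<phi> \<psi> y)"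

text \<open>For even functions the terms at an element and its negative merge, and the entries at
  \<open>I0\<close> and \<open>IPi\<close> supply the terms at 0; the result is a full sum over each
  group. In row \<open>IK k \<epsilon>\<close> the diagonal term of \<open>S\<close> changes sign
  with the column sign and drops out.\<close>

lemma transform:
  assumes \<phi>: "\<And>g. \<phi> (- g) = \<phi> g" "\<phi> 0 = 1" and \<psi>: "\<And>h. \<psi> (- h) = \<psi> h" "\<psi> 0 = 1"
  shows "transform \<phi> \<psi> I0 = (a\<^sup>2 * G.fourier \<phi> 0 + b\<^sup>2 * H.fourier \<psi> 0) / 2"
    and "transform \<phi> \<psi> IPi = (b\<^sup>2 * H.fourier \<psi> 0 - a\<^sup>2 * G.fourier \<phi> 0) / 2"
    and "k \<in> K \<Longrightarrow> transform \<phi> \<psi> (IK k \<epsilon>) = - (a\<^sup>2 / 2) * G.fourier \<phi> k"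
    and "transform \<phi> \<psi> (IG g) = - a\<^sup>2 * G.fourier \<phi> g"
    and "transform \<phi> \<psi> (IGamma \<gamma>) = b\<^sup>2 * H.fourier \<psi> \<gamma>"
  unfolding transform_def sum_J G.fourier_def H.fourier_def sum_G sum_H
  by (simp_all add: \<phi> \<psi> G.B_minus_right H.B_minus_right B_K_minus sum.distrib
      sum_negf sum_subtractf sum_distrib_left field_simps power2_eq_square)

definition weight :: "nat \<Rightarrow> ('g, 'h) index \<Rightarrow> complex" where
  "weight m w = transform (\<lambda>g. q1 g ^ m) (\<lambda>h. q2 h ^ m) w
     * transform (\<lambda>g. cnj (q1 g ^ m)) (\<lambda>h. cnj (q2 h ^ m)) w"

lemma FS_indicator_eq:
  "FS_indicator c q1 q2 Gs \<Gamma>s m z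
    = (\<Sum>w\<in>J Gs \<Gamma>s. S w (bar c q1 z) / S I0 w * weight m w)"
proof -
  let ?J = "J Gs \<Gamma>s"
  let ?T = "T_diag (\<lambda>g. q1 g ^ m) (\<lambda>h. q2 h ^ m) :: ('g, 'h) index \<Rightarrow> complex"
  let ?T' = "T_diag (\<lambda>g. cnj (q1 g ^ m)) (\<lambda>h. cnj (q2 h ^ m)) :: ('g, 'h) index \<Rightarrow> complex"
  \<comment> \<open>The entries of \<open>T_diag\<close> are unimodular, so inverting is
    conjugating; this separates the dependence on \<open>x\<close> from that on
    \<open>y\<close>.\<close>
  have T: "(T_diag q1 q2 y / T_diag q1 q2 x) ^ m = ?T y * ?T' x" for x y :: "('g, 'h) index"
  proof -
    have "inverse (T_diag q1 q2 x) = T_diag (\<lambda>g. cnj (q1 g)) (\<lambda>h. cnj (q2 h)) x"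
      by (cases x) (simp_all add: G.inverse_q H.inverse_q)
    then show ?thesis
      by (simp add: divide_inverse power_mult_distrib T_diag_power)
  qed
  have "FS_indicator c q1 q2 Gs \<Gamma>s m z
    = (\<Sum>x\<in>?J. \<Sum>y\<in>?J. \<Sum>w\<in>?J. S w (bar c q1 z) / S I0 w * (S w y * S I0 y * ?T y)
        * (S w x * S I0 x * ?T' x))"
    unfolding FS_indicator_def N_coeff_def S_mat_eq T sum_distrib_right
    by (intro sum.cong refl) simp
  also have "\<dots> = (\<Sum>x\<in>?J. \<Sum>w\<in>?J. \<Sum>y\<in>?J. S w (bar c q1 z) / S I0 w * (S w y * S I0 y * ?T y)
        * (S w x * S I0 x * ?T' x))"
    by (intro sum.cong refl sum.swap)
  also have "\<dots> = (\<Sum>w\<in>?J. \<Sum>x\<in>?J. \<Sum>y\<in>?J. S w (bar c q1 z) / S I0 w * (S w y * S I0 y * ?T y)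
        * (S w x * S I0 x * ?T' x))"
    by (rule sum.swap)
  also have "\<dots> = (\<Sum>w\<in>?J. S w (bar c q1 z) / S I0 w * weight m w)"
    unfolding weight_def transform_def
    by (simp add: sum_distrib_left sum_distrib_right mult.assoc)
  finally show ?thesis .
qed

text \<open>As \<open>a\<close> and \<open>b\<close> are real and the powers of \<open>q1\<close>
  and \<open>q2\<close> are even, the second factor of \<open>weight\<close> is the conjugate of the
  first.\<close>

lemma weight:
  fixes m :: nat
  defines "A \<equiv> gauss_sum q1 m" and "C \<equiv> gauss_sum q2 m"
  shows "weight m I0 = (a * A + b * C) * (a * cnj A + b * cnj C) / 4"
    and "weight m IPi = (b * C - a * A) * (b * cnj C - a * cnj A) / 4"
    and "k \<in> K \<Longrightarrow> weight m (IK k \<epsilon>) = a ^ 4 / 4 * G.energy m k"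
    and "weight m (IG g) = a ^ 4 * G.energy m g"
    and "weight m (IGamma \<gamma>) = b ^ 4 * H.energy m \<gamma>"
proof -
  have G0: "G.fourier (\<lambda>h. q1 h ^ m) 0 = A / a"
    using a_sqrt by (simp add: G.fourier_zero A_def field_simps)
  have H0: "H.fourier (\<lambda>h. q2 h ^ m) 0 = C / b"
    using b_sqrt by (simp add: H.fourier_zero C_def field_simps)
  have real_ab: "cnj a = a" "cnj b = b" by (simp_all add: a_def b_def)
  have cnj_eq: "G.fourier (\<lambda>h. cnj (q1 h) ^ m) g = cnj (G.fourier (\<lambda>h. q1 h ^ m) g)"
    "H.fourier (\<lambda>h. cnj (q2 h) ^ m) \<gamma> = cnj (H.fourier (\<lambda>h. q2 h ^ m) \<gamma>)" for g \<gamma>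
    using G.fourier_cnj[of "\<lambda>h. q1 h ^ m" g] H.fourier_cnj[of "\<lambda>h. q2 h ^ m" \<gamma>] by simp_all
  show "weight m I0 = (a * A + b * C) * (a * cnj A + b * cnj C) / 4"
    "weight m IPi = (b * C - a * A) * (b * cnj C - a * cnj A) / 4"
    by (simp_all add: weight_def transform cnj_eq G0 H0 real_ab power2_eq_square)
  show "k \<in> K \<Longrightarrow> weight m (IK k \<epsilon>) = a ^ 4 / 4 * G.energy m k"
    "weight m (IG g) = a ^ 4 * G.energy m g"
    "weight m (IGamma \<gamma>) = b ^ 4 * H.energy m \<gamma>"
    by (simp_all add: weight_def transform cnj_eq G.energy_def H.energy_def
        power2_eq_square power4_eq_xxxx)
qed


text \<open>This is \<open>fourier_energy\<close> with the terms at \<open>h\<close> and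
  \<open>- h\<close> joined and the term at 0 moved to the right.\<close>

lemma sum_K_energy_fold:
  "(\<Sum>k\<in>K. G.B k g * G.energy m k) + (\<Sum>h\<in>Gs. (G.B h g + cnj (G.B h g)) * G.energy m h)
    = (of_nat CARD('g))\<^sup>2 * (of_bool (nmult m g = 0) * q1 g ^ m) - G.energy m 0"
  using G.fourier_energy[of g m]
  by (simp add: sum_G G.energy_minus G.B_minus_left algebra_simps)

lemma sum_H_energy_fold:
  "(\<Sum>h\<in>\<Gamma>s. (H.B h g + cnj (H.B h g)) * H.energy m h)
    = (of_nat CARD('h))\<^sup>2 * (of_bool (nmult m g = 0) * q2 g ^ m) - H.energy m 0"
  using H.fourier_energy[of g m]
  by (simp add: sum_H H.energy_minus H.B_minus_left algebra_simps)

text \<open>The block sums shared by all the indicators. Each sign over \<open>k\<close> carries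
  \<open>a ^ 4 / 4\<close>, and half the weight at \<open>IG h\<close> carries
  \<open>a ^ 4 / 2\<close>, so the two blocks combine with the common factor
  \<open>a ^ 4 / 2\<close>.\<close>

lemma sum_weights:
  fixes m :: nat
  defines "A \<equiv> gauss_sum q1 m" and "C \<equiv> gauss_sum q2 m"
  shows "(\<Sum>k\<in>K. G.B k g * (weight m (IK k 1) + weight m (IK k (- 1))))
      + (\<Sum>h\<in>Gs. (G.B h g + cnj (G.B h g)) / 2 * weight m (IG h))
      = (of_bool (nmult m g = 0) * q1 g ^ m - a\<^sup>2 * (A * cnj A)) / 2"
    and "(\<Sum>h\<in>\<Gamma>s. (H.B h \<gamma> + cnj (H.B h \<gamma>)) * weight m (IGamma h))
      = of_bool (nmult m \<gamma> = 0) * q2 \<gamma> ^ m - b\<^sup>2 * (C * cnj C)"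
proof -
  have "(\<Sum>k\<in>K. G.B k g * (weight m (IK k 1) + weight m (IK k (- 1))))
      + (\<Sum>h\<in>Gs. (G.B h g + cnj (G.B h g)) / 2 * weight m (IG h))
    = a ^ 4 / 2 * ((\<Sum>k\<in>K. G.B k g * G.energy m k)
      + (\<Sum>h\<in>Gs. (G.B h g + cnj (G.B h g)) * G.energy m h))"
    unfolding distrib_left sum_distrib_left
    by (intro arg_cong2[where f = "(+)"] sum.cong refl) (simp_all add: weight field_simps)
  also have "\<dots> = ((a\<^sup>2 * of_nat CARD('g))\<^sup>2 * (of_bool (nmult m g = 0) * q1 g ^ m)
      - a\<^sup>2 * (a\<^sup>2 * of_nat CARD('g)) * (A * cnj A)) / 2"
    unfolding sum_K_energy_fold G.energy_zero A_def
    by (simp add: field_simps power2_eq_square power4_eq_xxxx)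
  finally show "(\<Sum>k\<in>K. G.B k g * (weight m (IK k 1) + weight m (IK k (- 1))))
      + (\<Sum>h\<in>Gs. (G.B h g + cnj (G.B h g)) / 2 * weight m (IG h))
      = (of_bool (nmult m g = 0) * q1 g ^ m - a\<^sup>2 * (A * cnj A)) / 2"
    unfolding a_square by simp
  have "(\<Sum>h\<in>\<Gamma>s. (H.B h \<gamma> + cnj (H.B h \<gamma>)) * weight m (IGamma h))
    = b ^ 4 * (\<Sum>h\<in>\<Gamma>s. (H.B h \<gamma> + cnj (H.B h \<gamma>)) * H.energy m h)"
    unfolding sum_distrib_left by (intro sum.cong refl) (simp add: weight algebra_simps)
  also have "\<dots> = (b\<^sup>2 * of_nat CARD('h))\<^sup>2 * (of_bool (nmult m \<gamma> = 0) * q2 \<gamma> ^ m)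
      - b\<^sup>2 * (b\<^sup>2 * of_nat CARD('h)) * (C * cnj C)"
    unfolding sum_H_energy_fold H.energy_zero C_def
    by (simp add: algebra_simps power2_eq_square power4_eq_xxxx)
  finally show "(\<Sum>h\<in>\<Gamma>s. (H.B h \<gamma> + cnj (H.B h \<gamma>)) * weight m (IGamma h))
      = of_bool (nmult m \<gamma> = 0) * q2 \<gamma> ^ m - b\<^sup>2 * (C * cnj C)"
    unfolding b_square by simp
qed


definition V :: "nat \<Rightarrow> real" where
  "V m = (cmod (gauss_sum q1 m + gauss_sum q2 m))\<^sup>2"

lemma V_eq: "complex_of_real (V m)
    = (gauss_sum q1 m + gauss_sum q2 m) * (cnj (gauss_sum q1 m) + cnj (gauss_sum q2 m))"
  unfolding V_def complex_norm_square by simp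

section \<open>The values of the indicators, block by block\<close>

text \<open>Both conditions also range over \<open>I0\<close>. All ratios
  \<open>S w I0 / S I0 w\<close> are 1, so the indicator is the total weight.\<close>

lemma FS_I0: "FS_indicator c q1 q2 Gs \<Gamma>s m I0 = 1"
proof -
  let ?A = "gauss_sum q1 m" and ?C = "gauss_sum q2 m"
  have nz: "b \<noteq> a" "a + b \<noteq> 0"
    using b_minus_a a_plus_b by auto
  \<comment> \<open>The pairings with 0 equal 1; they are written out so that
    \<open>sum_weights\<close> applies at 0.\<close>
  have "FS_indicator c q1 q2 Gs \<Gamma>s m I0 = weight m I0 + weight m IPi
      + (\<Sum>k\<in>K. G.B k 0 * (weight m (IK k 1) + weight m (IK k (- 1))))
      + (\<Sum>h\<in>Gs. (G.B h 0 + cnj (G.B h 0)) / 2 * weight m (IG h))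
      + (\<Sum>h\<in>\<Gamma>s. (H.B h 0 + cnj (H.B h 0)) * weight m (IGamma h) / 2)"
    unfolding FS_indicator_eq using nz by (intro sum_J_eqI) simp_all
  also have "\<dots> = weight m I0 + weight m IPi
      + ((\<Sum>k\<in>K. G.B k 0 * (weight m (IK k 1) + weight m (IK k (- 1))))
      + (\<Sum>h\<in>Gs. (G.B h 0 + cnj (G.B h 0)) / 2 * weight m (IG h)))
      + (\<Sum>h\<in>\<Gamma>s. (H.B h 0 + cnj (H.B h 0)) * weight m (IGamma h)) / 2"
    by (simp only: sum_divide_distrib add.assoc)
  also have "\<dots> = weight m I0 + weight m IPi
      + (1 - a\<^sup>2 * (?A * cnj ?A)) / 2 + (1 - b\<^sup>2 * (?C * cnj ?C)) / 2"
    unfolding sum_weights by (simp add: nmult_def)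
  also have "\<dots> = 1"
    unfolding weight by (simp add: field_simps power2_eq_square)
  finally show ?thesis .
qed

text \<open>The ratio is -1 on \<open>J1\<close> and \<open>Gs\<close> and 1 on
  \<open>\<Gamma>s\<close>. The delta terms at 0 therefore cancel, and the left-hand side of
  \<open>gauss_combination(1)\<close> remains.\<close>

lemma FS_IPi: "FS_indicator c q1 q2 Gs \<Gamma>s m IPi = of_real (V m)"
proof -
  let ?A = "gauss_sum q1 m" and ?C = "gauss_sum q2 m"
  let ?P = "(a + b) / (b - a) * weight m I0" and ?P' = "(b - a) / (a + b) * weight m IPi"
  have "FS_indicator c q1 q2 Gs \<Gamma>s m IPi = ?P + ?P'
      + (\<Sum>k\<in>K. - (G.B k 0 * (weight m (IK k 1) + weight m (IK k (- 1)))))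
      + (\<Sum>h\<in>Gs. - ((G.B h 0 + cnj (G.B h 0)) / 2 * weight m (IG h)))
      + (\<Sum>h\<in>\<Gamma>s. (H.B h 0 + cnj (H.B h 0)) * weight m (IGamma h) / 2)"
    unfolding FS_indicator_eq
    by (intro sum_J_eqI) (simp_all only: bar.simps S_entry.simps uminus_add_conv_diff half_ratio, simp_all)
  also have "\<dots> = ?P + ?P'
      - ((\<Sum>k\<in>K. G.B k 0 * (weight m (IK k 1) + weight m (IK k (- 1))))
      + (\<Sum>h\<in>Gs. (G.B h 0 + cnj (G.B h 0)) / 2 * weight m (IG h)))
      + (\<Sum>h\<in>\<Gamma>s. (H.B h 0 + cnj (H.B h 0)) * weight m (IGamma h)) / 2"
    unfolding sum_divide_distrib sum_negf by (simp only: diff_conv_add_uminus minus_add_distrib add.assoc)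
  also have "\<dots> = ?P + ?P' - (1 - a\<^sup>2 * (?A * cnj ?A)) / 2 + (1 - b\<^sup>2 * (?C * cnj ?C)) / 2"
    unfolding sum_weights by (simp add: nmult_def)
  also have "\<dots> = of_real (V m)"
    unfolding V_eq gauss_combination(1)[OF ab a_nonzero b_nonzero,
        where A = ?A and C = ?C and A' = "cnj ?A" and C' = "cnj ?C", symmetric] weight
    by (simp add: diff_divide_distrib)
  finally show ?thesis .
qed

text \<open>The ratio vanishes on \<open>\<Gamma>s\<close>, and on the other two blocks it gives -2
  times the first sum of \<open>sum_weights\<close>.\<close>

lemma FS_IG: "FS_indicator c q1 q2 Gs \<Gamma>s m (IG g)
    = of_real (V m) - of_bool (nmult m g = 0) * q1 g ^ m"
proof -
  let ?A = "gauss_sum q1 m" and ?C = "gauss_sum q2 m"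
  let ?P = "2 * a / (b - a) * weight m I0" and ?P' = "2 * a / (a + b) * weight m IPi"
  have "FS_indicator c q1 q2 Gs \<Gamma>s m (IG g) = ?P + - ?P'
      + (\<Sum>k\<in>K. - 2 * (G.B k g * (weight m (IK k 1) + weight m (IK k (- 1)))))
      + (\<Sum>h\<in>Gs. - 2 * ((G.B h g + cnj (G.B h g)) / 2 * weight m (IG h)))
      + (\<Sum>h\<in>\<Gamma>s. 0)"
    unfolding FS_indicator_eq by (intro sum_J_eqI) (simp_all add: field_simps)
  also have "\<dots> = ?P - ?P'
      - 2 * ((\<Sum>k\<in>K. G.B k g * (weight m (IK k 1) + weight m (IK k (- 1))))
      + (\<Sum>h\<in>Gs. (G.B h g + cnj (G.B h g)) / 2 * weight m (IG h)))"
    unfolding sum_distrib_left[symmetric] by (simp add: distrib_left)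
  also have "\<dots> = ?P - ?P' + a\<^sup>2 * (?A * cnj ?A) - of_bool (nmult m g = 0) * q1 g ^ m"
    unfolding sum_weights by (simp add: diff_divide_distrib)
  also have "\<dots> = of_real (V m) - of_bool (nmult m g = 0) * q1 g ^ m"
    unfolding V_eq gauss_combination(2)[OF ab a_nonzero b_nonzero,
        where A = ?A and C = ?C and A' = "cnj ?A" and C' = "cnj ?C", symmetric] weight by simp
  finally show ?thesis .
qed

text \<open>The diagonal term of \<open>S\<close> is odd in the sign of \<open>w\<close> while
  \<open>weight\<close> is even, so it cancels. What remains is half of the expression found for
  \<open>IG\<close>, whatever sign the involution gives to \<epsilon>.\<close>

lemma FS_IK:
  assumes "k \<in> K"
  shows "FS_indicator c q1 q2 Gs \<Gamma>s m (IK k \<epsilon>)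
    = (of_real (V m) - of_bool (nmult m k = 0) * q1 k ^ m) / 2"
proof -
  let ?A = "gauss_sum q1 m" and ?C = "gauss_sum q2 m"
  let ?P = "2 * a / (b - a) * weight m I0" and ?P' = "2 * a / (a + b) * weight m IPi"
  have weight_sign: "weight m (IK k' (- 1)) = weight m (IK k' 1)" if "k' \<in> K" for k'
    using that by (simp add: weight)
  have cnj_B: "cnj (G.B h k) = G.B h k" for h
    using B_K_minus[of k h] assms by (simp add: G.B_commute)
  have "FS_indicator c q1 q2 Gs \<Gamma>s m (IK k \<epsilon>) = ?P / 2 + - ?P' / 2
      + (\<Sum>k'\<in>K. - (G.B k' k * (weight m (IK k' 1) + weight m (IK k' (- 1)))))
      + (\<Sum>h\<in>Gs. - ((G.B h k + cnj (G.B h k)) / 2 * weight m (IG h)))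
      + (\<Sum>h\<in>\<Gamma>s. 0)"
    unfolding FS_indicator_eq
  proof (intro sum_J_eqI)
    show "S I0 (bar c q1 (IK k \<epsilon>)) / S I0 I0 * weight m I0 = ?P / 2"
      by (simp only: bar.simps S_entry.simps uminus_add_conv_diff half_ratio half_double)
    show "S IPi (bar c q1 (IK k \<epsilon>)) / S I0 IPi * weight m IPi = - ?P' / 2"
      by (simp only: bar.simps S_entry.simps half_ratio half_double)
  qed (simp_all add: weight_sign cnj_B field_simps)
  also have "\<dots> = ?P / 2 - ?P' / 2
      - ((\<Sum>k'\<in>K. G.B k' k * (weight m (IK k' 1) + weight m (IK k' (- 1))))
      + (\<Sum>h\<in>Gs. (G.B h k + cnj (G.B h k)) / 2 * weight m (IG h)))"
    unfolding sum_negf by simp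
  also have "\<dots> = (?P - ?P' + a\<^sup>2 * (?A * cnj ?A) - of_bool (nmult m k = 0) * q1 k ^ m) / 2"
    unfolding sum_weights by (simp only: diff_divide_distrib add_divide_distrib) simp
  also have "\<dots> = (of_real (V m) - of_bool (nmult m k = 0) * q1 k ^ m) / 2"
    unfolding V_eq gauss_combination(2)[OF ab a_nonzero b_nonzero,
        where A = ?A and C = ?C and A' = "cnj ?A" and C' = "cnj ?C", symmetric] weight by simp
  finally show ?thesis .
qed

lemma FS_IGamma: "FS_indicator c q1 q2 Gs \<Gamma>s m (IGamma \<gamma>)
    = of_real (V m) + of_bool (nmult m \<gamma> = 0) * q2 \<gamma> ^ m"
proof -
  let ?A = "gauss_sum q1 m" and ?C = "gauss_sum q2 m"
  let ?P = "2 * b / (b - a) * weight m I0" and ?P' = "2 * b / (a + b) * weight m IPi"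
  have "FS_indicator c q1 q2 Gs \<Gamma>s m (IGamma \<gamma>) = ?P + ?P' + (\<Sum>k\<in>K. 0) + (\<Sum>h\<in>Gs. 0)
      + (\<Sum>h\<in>\<Gamma>s. (H.B h \<gamma> + cnj (H.B h \<gamma>)) * weight m (IGamma h))"
    unfolding FS_indicator_eq by (intro sum_J_eqI) (simp_all add: mult_ac)
  also have "\<dots> = ?P + ?P' - b\<^sup>2 * (?C * cnj ?C) + of_bool (nmult m \<gamma> = 0) * q2 \<gamma> ^ m"
    unfolding sum_weights by simp
  also have "\<dots> = of_real (V m) + of_bool (nmult m \<gamma> = 0) * q2 \<gamma> ^ m"
    unfolding V_eq gauss_combination(3)[OF ab a_nonzero b_nonzero,
        where A = ?A and C = ?C and A' = "cnj ?A" and C' = "cnj ?C", symmetric] weight by simp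
  finally show ?thesis .
qed


section \<open>The fusion coefficients and the Frobenius--Schur conditions\<close>

abbreviation N where "N x \<equiv> N_coeff c q1 q2 Gs \<Gamma>s x x x"

lemma N_eq: "N x = (\<Sum>w\<in>J Gs \<Gamma>s. S w x ^ 3 / S I0 w)"
  by (simp add: N_coeff_def S_mat_eq power3_eq_cube)

lemma sum_K_B_fold:
  "(\<Sum>k\<in>K. G.B k g) + (\<Sum>h\<in>Gs. G.B h g + cnj (G.B h g))
    = of_bool (g = 0) * of_nat CARD('g) - 1"
  using G.sum_B[of g] by (simp add: sum_G G.B_minus_left algebra_simps)

lemma sum_H_B_fold:
  "(\<Sum>h\<in>\<Gamma>s. H.B h \<gamma> + cnj (H.B h \<gamma>)) = of_bool (\<gamma> = 0) * of_nat CARD('h) - 1"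
  using H.sum_B[of \<gamma>] by (simp add: sum_H H.B_minus_left algebra_simps)

lemma a_card: "a\<^sup>2 * (of_nat CARD('g) - 1) = 1 - a\<^sup>2"
  and b_card: "b\<^sup>2 * (of_nat CARD('h) - 1) = 1 - b\<^sup>2"
  using a_square b_square by (simp_all add: algebra_simps)

lemma cube_divide_self: "x ^ 3 / x = x\<^sup>2" for x :: complex
  by (simp add: power3_eq_cube power2_eq_square)

lemma cube_divide_half: "(x / 2) ^ 3 / (x / 2) = x\<^sup>2 / 4" for x :: complex
  unfolding cube_divide_self by (simp add: power_divide)

lemma N_I0: "N I0 = 1"
proof -
  \<comment> \<open>The factors \<open>G.B k 0\<close> and \<open>H.B h 0\<close> are 1; with them
    the orthogonality relations count the indices of the blocks.\<close>
  have "N I0 = (b - a)\<^sup>2 / 4 + (a + b)\<^sup>2 / 4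
      + (\<Sum>k\<in>K. a\<^sup>2 / 2 * G.B k 0) + (\<Sum>h\<in>Gs. a\<^sup>2 / 2 * (G.B h 0 + cnj (G.B h 0)))
      + (\<Sum>h\<in>\<Gamma>s. b\<^sup>2 / 2 * (H.B h 0 + cnj (H.B h 0)))"
    unfolding N_eq
    by (intro sum_J_eqI) (simp_all only: S_entry.simps uminus_add_conv_diff cube_divide_half
        cube_divide_self G.B_zero_right H.B_zero_right complex_cnj_one mult_1_right, simp_all add: power_divide)
  also have "\<dots> = (b - a)\<^sup>2 / 4 + (a + b)\<^sup>2 / 4
      + a\<^sup>2 / 2 * ((\<Sum>k\<in>K. G.B k 0) + (\<Sum>h\<in>Gs. G.B h 0 + cnj (G.B h 0)))
      + b\<^sup>2 / 2 * (\<Sum>h\<in>\<Gamma>s. H.B h 0 + cnj (H.B h 0))"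
    by (simp only: sum_distrib_left distrib_left add.assoc)
  also have "\<dots> = (b - a)\<^sup>2 / 4 + (a + b)\<^sup>2 / 4
      + a\<^sup>2 * (of_nat CARD('g) - 1) / 2 + b\<^sup>2 * (of_nat CARD('h) - 1) / 2"
    unfolding sum_K_B_fold sum_H_B_fold by simp
  also have "\<dots> = 1"
    unfolding a_card b_card by (simp add: field_simps power2_eq_square)
  finally show ?thesis .
qed

lemma N_IPi: "N IPi = 4"
proof -
  let ?P = "((a + b) / 2) ^ 3 / ((b - a) / 2)" and ?P' = "((b - a) / 2) ^ 3 / ((a + b) / 2)"
  have neg: "(- x) ^ 3 / x = - x\<^sup>2" "(- x / 2) ^ 3 / (x / 2) = - x\<^sup>2 / 4" for x :: complex
    by (simp_all add: power3_eq_cube power2_eq_square)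
  have "N IPi = ?P + ?P'
      + (\<Sum>k\<in>K. - (a\<^sup>2 / 2) * G.B k 0) + (\<Sum>h\<in>Gs. - (a\<^sup>2 / 2) * (G.B h 0 + cnj (G.B h 0)))
      + (\<Sum>h\<in>\<Gamma>s. b\<^sup>2 / 2 * (H.B h 0 + cnj (H.B h 0)))"
    unfolding N_eq
    by (intro sum_J_eqI) (simp_all only: S_entry.simps uminus_add_conv_diff cube_divide_half
        cube_divide_self neg G.B_zero_right H.B_zero_right complex_cnj_one mult_1_right, simp_all add: power_divide)
  also have "\<dots> = ?P + ?P'
      + - (a\<^sup>2 / 2) * ((\<Sum>k\<in>K. G.B k 0) + (\<Sum>h\<in>Gs. G.B h 0 + cnj (G.B h 0)))
      + b\<^sup>2 / 2 * (\<Sum>h\<in>\<Gamma>s. H.B h 0 + cnj (H.B h 0))"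
    by (simp only: sum_distrib_left distrib_left add.assoc)
  also have "\<dots> = 4 + (b\<^sup>2 - a\<^sup>2) / 2
      - a\<^sup>2 * (of_nat CARD('g) - 1) / 2 + b\<^sup>2 * (of_nat CARD('h) - 1) / 2"
    unfolding sum_K_B_fold sum_H_B_fold fusion_combination(1)[OF ab a_nonzero b_nonzero] by simp
  also have "\<dots> = 4"
    unfolding a_card b_card by (simp add: field_simps)
  finally show ?thesis .
qed

text \<open>Adding the cubes for both signs keeps the even powers of the diagonal term
  \<open>s\<close>. Here \<open>s\<^sup>2 = - G.B k k\<close> because \<open>c\<^sup>2 = -1\<close>,
  and this contributes 3/2; the other terms add up to 1/2.\<close>

lemma N_IK:
  assumes k: "k \<in> K" and \<epsilon>: "\<epsilon> \<in> {1, - 1}"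
  shows "N (IK k \<epsilon>) = 2"
proof -
  have cube: "G.B h k ^ 3 = G.B h k" "cnj (G.B h k) = G.B h k" for h
    using B_K_minus[of k h] B_K_square[of k h] k by (simp_all add: G.B_commute power3_eq_cube)
  have pair: "S (IK k' 1) (IK k \<epsilon>) ^ 3 / S I0 (IK k' 1) + S (IK k' (- 1)) (IK k \<epsilon>) ^ 3 / S I0 (IK k' (- 1))
      = - (a\<^sup>2 / 2) * G.B k' k + (if k' = k then 3 / 2 else 0)" if "k' \<in> K" for k'
  proof -
    define s where "s = c * \<epsilon> * q1 k' * of_bool (k' = k)"
    have s: "s\<^sup>2 = (if k' = k then - G.B k k else 0)"
      using \<epsilon> by (auto simp: s_def power_mult_distrib c_square G.B_self)
    have "S (IK k' 1) (IK k \<epsilon>) = - ((a * G.B k' k + s) / 2)"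
      "S (IK k' (- 1)) (IK k \<epsilon>) = - ((a * G.B k' k - s) / 2)" "S I0 (IK k' \<epsilon>') = a / 2" for \<epsilon>'
      by (simp_all add: s_def)
    then have "S (IK k' 1) (IK k \<epsilon>) ^ 3 / S I0 (IK k' 1) + S (IK k' (- 1)) (IK k \<epsilon>) ^ 3 / S I0 (IK k' (- 1))
        = (- ((a * G.B k' k + s) / 2)) ^ 3 / (a / 2) + (- ((a * G.B k' k - s) / 2)) ^ 3 / (a / 2)"
      by (simp only:)
    also have "\<dots> = - (a\<^sup>2 / 2) * G.B k' k ^ 3 - 3 / 2 * G.B k' k * s\<^sup>2"
      by (simp add: divide_simps) (simp add: algebra_simps power2_eq_square power3_eq_cube)
    finally show ?thesis
      unfolding s cube using B_K_square[of k k] k by auto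
  qed
  have "N (IK k \<epsilon>) = a ^ 3 / ((b - a) / 2) / 8 + - (a ^ 3 / ((a + b) / 2)) / 8
      + (\<Sum>k'\<in>K. - (a\<^sup>2 / 2) * G.B k' k + (if k' = k then 3 / 2 else 0))
      + (\<Sum>h\<in>Gs. - (a\<^sup>2 / 2) * (G.B h k + cnj (G.B h k))) + (\<Sum>h\<in>\<Gamma>s. 0)"
    unfolding N_eq
  proof (intro sum_J_eqI pair)
    show "S I0 (IK k \<epsilon>) ^ 3 / S I0 I0 = a ^ 3 / ((b - a) / 2) / 8"
      by (simp only: S_entry.simps uminus_add_conv_diff half_cube)
    have "(- x) ^ 3 = - (x ^ 3)" for x :: complex by simp
    then show "S IPi (IK k \<epsilon>) ^ 3 / S I0 IPi = - (a ^ 3 / ((a + b) / 2)) / 8"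
      by (simp only: S_entry.simps half_cube minus_divide_left)
  next
    fix g
    have "S (IG g) (IK k \<epsilon>) ^ 3 / S I0 (IG g) = - (a\<^sup>2 * G.B g k ^ 3)"
      by (simp add: power3_eq_cube power2_eq_square)
    then show "S (IG g) (IK k \<epsilon>) ^ 3 / S I0 (IG g) = - (a\<^sup>2 / 2) * (G.B g k + cnj (G.B g k))"
      unfolding cube by simp
  qed simp_all
  also have "\<dots> = (a ^ 3 / ((b - a) / 2) - a ^ 3 / ((a + b) / 2)) / 8 + 3 / 2
      + - (a\<^sup>2 / 2) * ((\<Sum>k'\<in>K. G.B k' k) + (\<Sum>h\<in>Gs. G.B h k + cnj (G.B h k)))"
    using k unfolding sum.distrib sum_distrib_left[symmetric] distrib_left
    by (simp add: diff_divide_distrib)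
  also have "\<dots> = 2"
    unfolding sum_K_B_fold fusion_combination(2)[OF ab a_nonzero b_nonzero]
    using k by (simp add: field_simps)
  finally show ?thesis .
qed

text \<open>The cube of a character sum is expanded into the characters of \<open>nmult 3 g\<close>
  and \<open>g\<close>. By orthogonality the former detects \<open>nmult 3 g = 0\<close>, and the
  latter is evaluated using \<open>g \<noteq> 0\<close>.\<close>

lemma N_IG:
  assumes g: "g \<in> Gs"
  shows "N (IG g) = 4 - of_bool (nmult 3 g = 0)"
proof -
  have g0: "g \<noteq> 0"
    using g splits_G zero_in_two_torsion unfolding splits_as_def by blast
  have B3: "G.B h (nmult 3 g) = G.B h g ^ 3" for h
    using G.B_nmult_left[of 3 g h] by (simp add: G.B_commute)
  \<comment> \<open>As \<open>G.B k g\<close> is a sign, its cube is itself; this form matches the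
    expansion \<open>G3\<close> on \<open>Gs\<close>.\<close>
  have K3: "G.B k g ^ 3 = (G.B k (nmult 3 g) + 3 * G.B k g) / 4" if "k \<in> K" for k
    using B_K_square[of k g] that by (simp add: B3 power3_eq_cube)
  have G3: "(G.B h g + cnj (G.B h g)) ^ 3
      = (G.B h (nmult 3 g) + cnj (G.B h (nmult 3 g))) + 3 * (G.B h g + cnj (G.B h g))" for h
  proof -
    have "(G.B h g + cnj (G.B h g)) ^ 3
      = G.B h g ^ 3 + cnj (G.B h g) ^ 3
        + 3 * (G.B h g * cnj (G.B h g)) * (G.B h g + cnj (G.B h g))"
      by (simp add: power3_eq_cube algebra_simps del: G.B_cnj)
    then show ?thesis by (simp add: B3)
  qed
  have "N (IG g) = a ^ 3 / ((b - a) / 2) + - (a ^ 3 / ((a + b) / 2))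
      + (\<Sum>k\<in>K. - (a\<^sup>2) * (G.B k (nmult 3 g) + 3 * G.B k g))
      + (\<Sum>h\<in>Gs. - (a\<^sup>2) * ((G.B h (nmult 3 g) + cnj (G.B h (nmult 3 g)))
          + 3 * (G.B h g + cnj (G.B h g)))) + (\<Sum>h\<in>\<Gamma>s. 0)"
    unfolding N_eq
  proof (intro sum_J_eqI)
    fix k assume "k \<in> K"
    have "S (IK k \<epsilon>) (IG g) ^ 3 / S I0 (IK k \<epsilon>) = - 2 * a\<^sup>2 * G.B k g ^ 3" for \<epsilon>
      by (simp add: power3_eq_cube power2_eq_square)
    then show "S (IK k 1) (IG g) ^ 3 / S I0 (IK k 1) + S (IK k (- 1)) (IG g) ^ 3 / S I0 (IK k (- 1))
        = - (a\<^sup>2) * (G.B k (nmult 3 g) + 3 * G.B k g)"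
      unfolding K3[OF \<open>k \<in> K\<close>] by simp
  next
    fix h
    have "S (IG h) (IG g) ^ 3 / S I0 (IG h) = - (a\<^sup>2) * (G.B h g + cnj (G.B h g)) ^ 3"
      by (simp add: power_mult_distrib) (simp add: power3_eq_cube power2_eq_square)
    then show "S (IG h) (IG g) ^ 3 / S I0 (IG h)
        = - (a\<^sup>2) * ((G.B h (nmult 3 g) + cnj (G.B h (nmult 3 g))) + 3 * (G.B h g + cnj (G.B h g)))"
      unfolding G3 .
  qed simp_all
  also have "\<dots> = a ^ 3 / ((b - a) / 2) - a ^ 3 / ((a + b) / 2)
      - a\<^sup>2 * ((\<Sum>k\<in>K. G.B k (nmult 3 g)) + (\<Sum>h\<in>Gs. G.B h (nmult 3 g) + cnj (G.B h (nmult 3 g))))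
      - a\<^sup>2 * (3 * ((\<Sum>k\<in>K. G.B k g) + (\<Sum>h\<in>Gs. G.B h g + cnj (G.B h g))))"
    unfolding sum_distrib_left[symmetric] sum.distrib by (simp add: algebra_simps)
  also have "\<dots> = 4 - of_bool (nmult 3 g = 0) * (a\<^sup>2 * of_nat CARD('g))"
    unfolding sum_K_B_fold fusion_combination(2)[OF ab a_nonzero b_nonzero]
    using g0 by (simp add: algebra_simps)
  finally show ?thesis unfolding a_square by simp
qed

text \<open>The same expansion as for \<open>IG\<close>; the entries of \<open>S\<close> have a
  positive sign here, hence the plus before the delta.\<close>

lemma N_IGamma:
  assumes g: "g \<in> \<Gamma>s"
  shows "N (IGamma g) = 4 + of_bool (nmult 3 g = 0)"
proof -
  have g0: "g \<noteq> 0"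
    using g splits_H unfolding splits_as_def by blast
  have B3: "H.B h (nmult 3 g) = H.B h g ^ 3" for h
    using H.B_nmult_left[of 3 g h] by (simp add: H.B_commute)
  have H3: "(H.B h g + cnj (H.B h g)) ^ 3
      = (H.B h (nmult 3 g) + cnj (H.B h (nmult 3 g))) + 3 * (H.B h g + cnj (H.B h g))" for h
  proof -
    have "(H.B h g + cnj (H.B h g)) ^ 3
      = H.B h g ^ 3 + cnj (H.B h g) ^ 3
        + 3 * (H.B h g * cnj (H.B h g)) * (H.B h g + cnj (H.B h g))"
      by (simp add: power3_eq_cube algebra_simps del: H.B_cnj)
    then show ?thesis by (simp add: B3)
  qed
  have "N (IGamma g) = b ^ 3 / ((b - a) / 2) + b ^ 3 / ((a + b) / 2)
      + (\<Sum>k\<in>K. 0) + (\<Sum>h\<in>Gs. 0)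
      + (\<Sum>h\<in>\<Gamma>s. b\<^sup>2 * ((H.B h (nmult 3 g) + cnj (H.B h (nmult 3 g)))
          + 3 * (H.B h g + cnj (H.B h g))))"
    unfolding N_eq
  proof (intro sum_J_eqI)
    fix h
    have "S (IGamma h) (IGamma g) ^ 3 / S I0 (IGamma h) = b\<^sup>2 * (H.B h g + cnj (H.B h g)) ^ 3"
      by (simp add: power_mult_distrib) (simp add: power3_eq_cube power2_eq_square)
    then show "S (IGamma h) (IGamma g) ^ 3 / S I0 (IGamma h)
        = b\<^sup>2 * ((H.B h (nmult 3 g) + cnj (H.B h (nmult 3 g))) + 3 * (H.B h g + cnj (H.B h g)))"
      unfolding H3 .
  qed simp_all
  also have "\<dots> = b ^ 3 / ((b - a) / 2) + b ^ 3 / ((a + b) / 2)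
      + b\<^sup>2 * (\<Sum>h\<in>\<Gamma>s. H.B h (nmult 3 g) + cnj (H.B h (nmult 3 g)))
      + b\<^sup>2 * (3 * (\<Sum>h\<in>\<Gamma>s. H.B h g + cnj (H.B h g)))"
    unfolding sum_distrib_left[symmetric] sum.distrib by (simp add: algebra_simps)
  also have "\<dots> = 4 + of_bool (nmult 3 g = 0) * (b\<^sup>2 * of_nat CARD('h))"
    unfolding sum_H_B_fold fusion_combination(3)[OF ab a_nonzero b_nonzero]
    using g0 by (simp add: algebra_simps)
  finally show ?thesis unfolding b_square by simp
qed


section \<open>The equivalences for (FS2) and (FS3)\<close>

lemma V_nonneg: "V m \<ge> 0"
  by (simp add: V_def)

lemma index_cases:
  assumes "x \<in> J Gs \<Gamma>s"
  obtains "x = I0" | "x = IPi"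
  | k \<epsilon> where "x = IK k \<epsilon>" "k \<in> K" "\<epsilon> \<in> {1, - 1}"
  | g where "x = IG g" "g \<in> Gs" | \<gamma> where "x = IGamma \<gamma>" "\<gamma> \<in> \<Gamma>s"
proof -
  have "x \<in> {I0, IPi} \<or> x \<in> (\<lambda>(k, \<epsilon>). IK k \<epsilon>) ` J1 \<or> x \<in> IG ` Gs \<or> x \<in> IGamma ` \<Gamma>s"
    using assms unfolding J_def by blast
  then show thesis
    using that by (elim disjE insertE imageE emptyE) (auto simp: J1_def)
qed

lemma index_in_J:
  "I0 \<in> J Gs \<Gamma>s" "IPi \<in> J Gs \<Gamma>s" "k \<in> K \<Longrightarrow> \<epsilon> \<in> {1, - 1} \<Longrightarrow> IK k \<epsilon> \<in> J Gs \<Gamma>s"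
  by (auto simp: J_def J1_def)

text \<open>The index \<open>IPi\<close> alone forces \<open>V 2\<close> to be 1 or -1, and it is
  not negative. Conversely, \<open>Gs\<close> and \<open>\<Gamma>s\<close> contain no 2-torsion, so
  only \<open>J1\<close> needs a closer look.\<close>

theorem FS2_iff: "FS2 c q1 q2 Gs \<Gamma>s \<longleftrightarrow> V 2 = 1"
proof
  assume "FS2 c q1 q2 Gs \<Gamma>s"
  then have "FS_indicator c q1 q2 Gs \<Gamma>s 2 IPi \<in> {1, - 1}"
    unfolding FS2_def using index_in_J(2) by force
  then have "complex_of_real (V 2) \<in> {of_real 1, of_real (- 1)}"
    by (simp add: FS_IPi)
  then have "V 2 = 1 \<or> V 2 = - 1"
    unfolding insert_iff of_real_eq_iff by simp
  then show "V 2 = 1" using V_nonneg[of 2] by linarith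
next
  assume V: "V 2 = 1"
  show "FS2 c q1 q2 Gs \<Gamma>s"
    unfolding FS2_def
  proof
    fix x assume "x \<in> J Gs \<Gamma>s"
    then show "(x \<noteq> bar c q1 x \<longrightarrow> FS_indicator c q1 q2 Gs \<Gamma>s 2 x = 0) \<and>
        (x = bar c q1 x \<longrightarrow> FS_indicator c q1 q2 Gs \<Gamma>s 2 x \<in> {1, - 1})"
    proof (cases x rule: index_cases)
      case (3 k \<epsilon>)
      \<comment> \<open>Here \<open>(q1 k)\<^sup>2 = G.B k k\<close> is a sign. If it is 1, the
        involution flips \<epsilon> and the indicator is 0; if it is -1, the index is fixed and the
        indicator is 1.\<close>
      have "nmult 2 k = 0" using 3 by (simp add: two_torsion_def)
      then have FS: "FS_indicator c q1 q2 Gs \<Gamma>s 2 x = (1 - G.B k k) / 2"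
        by (simp add: 3(1) FS_IK[OF 3(2)] V G.B_self)
      have "(G.B k k)\<^sup>2 = 1" using B_K_square[of k k] 3 by (simp add: power2_eq_square)
      then consider "G.B k k = 1" | "G.B k k = - 1" by (auto simp: power2_eq_1_iff)
      then show ?thesis
      proof cases
        case 1
        then have "bar c q1 x = IK k (- \<epsilon>)" by (simp add: 3 c_square)
        then have "x \<noteq> bar c q1 x" using 3 by auto
        then show ?thesis using FS 1 by simp
      next
        case 2
        then have "bar c q1 x = x" by (simp add: 3 c_square)
        then show ?thesis using FS 2 by simp
      qed
    next
      case (4 g)
      then have "g \<notin> two_torsion" using splits_G unfolding splits_as_def by blast
      then show ?thesis by (simp add: 4 FS_IG V two_torsion_def)
    next
      case (5 \<gamma>)
      then have "\<gamma> \<noteq> 0" using splits_H unfolding splits_as_def by blast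
      then have "nmult 2 \<gamma> \<noteq> 0" using H_no_two_torsion[of \<gamma>] unfolding nmult_2 by blast
      then show ?thesis by (simp add: 5 FS_IGamma V)
    qed (simp_all add: FS_I0 FS_IPi V)
  qed
qed

lemma nmult_3_two_torsion: "k \<in> K \<Longrightarrow> nmult 3 k \<noteq> 0"
proof -
  assume k: "k \<in> K"
  then have "k + k = 0" "k \<noteq> 0" by (auto simp: two_torsion_def nmult_2)
  then show "nmult 3 k \<noteq> 0" by (simp only: nmult_3 add_0_left not_False_eq_True)
qed

theorem FS3_iff: "FS3 c q1 q2 Gs \<Gamma>s \<longleftrightarrow> V 3 = 4"
proof
  assume FS3: "FS3 c q1 q2 Gs \<Gamma>s"
  obtain k where k: "k \<in> K" using K_nonempty by blast
  obtain M where M: "of_nat (size M) = N (IK k 1)"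
    "set_mset M \<subseteq> {1, exp (2 * of_real pi * \<i> / 3), exp (4 * of_real pi * \<i> / 3)}"
    "FS_indicator c q1 q2 Gs \<Gamma>s 3 (IK k 1) = sum_mset M"
    using FS3 index_in_J(3)[OF k, of 1] unfolding FS3_def by blast
  have "complex_of_nat (size M) = of_nat 2"
    using M(1) N_IK[OF k, of 1] by simp
  then have "size M = 2" unfolding of_nat_eq_iff .
  moreover have "sum_mset M = of_real (V 3 / 2)"
    using M(3) by (simp add: FS_IK[OF k] nmult_3_two_torsion[OF k])
  ultimately have "V 3 / 2 = 2"
    using V_nonneg[of 3] by (intro sum_of_two_cube_roots[OF M(2)]) simp_all
  then show "V 3 = 4" by simp
next
  assume V: "V 3 = 4"
  \<comment> \<open>For \<open>V 3 = 4\<close> every third indicator equals the corresponding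
    \<open>N x\<close>, so a multiset of ones of that size is a witness.\<close>
  have ones: "\<exists>M :: complex multiset. of_nat (size M) = of_nat j \<and>
      set_mset M \<subseteq> {1, exp (2 * of_real pi * \<i> / 3), exp (4 * of_real pi * \<i> / 3)} \<and>
      of_nat j = sum_mset M" for j :: nat
    by (rule exI[of _ "replicate_mset j 1"]) auto
  have naturals: "\<exists>j. N x = of_nat j \<and> FS_indicator c q1 q2 Gs \<Gamma>s 3 x = of_nat j" if "x \<in> J Gs \<Gamma>s" for x
    using that
  proof (cases x rule: index_cases)
    case 1
    then show ?thesis by (intro exI[of _ 1]) (simp add: N_I0 FS_I0)
  next
    case 2
    then show ?thesis by (intro exI[of _ 4]) (simp add: N_IPi FS_IPi V)
  next
    case (3 k \<epsilon>)
    then show ?thesis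
      by (intro exI[of _ 2]) (simp add: N_IK FS_IK V nmult_3_two_torsion)
  next
    case (4 g)
    have "q1 g ^ 3 = 1" if "nmult 3 g = 0"
      by (rule G.q_power_three_torsion[OF that])
    then show ?thesis
      using 4 by (intro exI[of _ "if nmult 3 g = 0 then 3 else 4"]) (simp add: N_IG FS_IG V)
  next
    case (5 \<gamma>)
    have "q2 \<gamma> ^ 3 = 1" if "nmult 3 \<gamma> = 0"
      by (rule H.q_power_three_torsion[OF that])
    then show ?thesis
      using 5 by (intro exI[of _ "if nmult 3 \<gamma> = 0 then 5 else 4"]) (simp add: N_IGamma FS_IGamma V)
  qed
  show "FS3 c q1 q2 Gs \<Gamma>s"
    unfolding FS3_def
  proof
    fix x assume "x \<in> J Gs \<Gamma>s"
    from naturals[OF this] obtain j where j: "N x = of_nat j" "FS_indicator c q1 q2 Gs \<Gamma>s 3 x = of_nat j"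
      by blast
    show "\<exists>M :: complex multiset. of_nat (size M) = N x \<and>
        set_mset M \<subseteq> {1, exp (2 * of_real pi * \<i> / 3), exp (4 * of_real pi * \<i> / 3)} \<and>
        FS_indicator c q1 q2 Gs \<Gamma>s 3 x = sum_mset M"
      unfolding j by (rule ones)
  qed
qed

end

theorem theorem7p5:
  fixes q1 :: "'g::{finite, ab_group_add} \<Rightarrow> complex"
    and q2 :: "'h::{finite, ab_group_add} \<Rightarrow> complex"
    and c :: complex
    and Gs :: "'g set" and \<Gamma>s :: "'h set"
  assumes "metric_group q1" and "metric_group q2"
    and "even CARD('g)" and "odd CARD('h)"
    and "c = gauss_sum q1 1" and "c = - gauss_sum q2 1"
    and "CARD('h) = CARD('g) - 1"
    and "iso_Z2_Z2 (two_torsion :: 'g set)"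
    and "splits_as two_torsion Gs" and "splits_as {0} \<Gamma>s"
  shows "(\<forall>m.
      FS_indicator c q1 q2 Gs \<Gamma>s m IPi
        = of_real ((cmod (gauss_sum q1 m + gauss_sum q2 m))\<^sup>2) \<and>
      (\<forall>(k, \<epsilon>)\<in>J1. FS_indicator c q1 q2 Gs \<Gamma>s m (IK k \<epsilon>)
        = (of_real ((cmod (gauss_sum q1 m + gauss_sum q2 m))\<^sup>2)
            - of_bool (nmult m k = 0) * q1 k ^ m) / 2) \<and>
      (\<forall>g\<in>Gs. FS_indicator c q1 q2 Gs \<Gamma>s m (IG g)
        = of_real ((cmod (gauss_sum q1 m + gauss_sum q2 m))\<^sup>2)
            - of_bool (nmult m g = 0) * q1 g ^ m) \<and>
      (\<forall>\<gamma>\<in>\<Gamma>s. FS_indicator c q1 q2 Gs \<Gamma>s m (IGamma \<gamma>)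
        = of_real ((cmod (gauss_sum q1 m + gauss_sum q2 m))\<^sup>2)
            + of_bool (nmult m \<gamma> = 0) * q2 \<gamma> ^ m))
    \<and> (FS2 c q1 q2 Gs \<Gamma>s \<longleftrightarrow> (cmod (gauss_sum q1 2 + gauss_sum q2 2))\<^sup>2 = 1)
    \<and> (FS3 c q1 q2 Gs \<Gamma>s \<longleftrightarrow> (cmod (gauss_sum q1 3 + gauss_sum q2 3))\<^sup>2 = 4)"
proof -
  have "modular_data q1 q2 c Gs \<Gamma>s"
    unfolding modular_data_def metric_grp_def modular_data_axioms_def using assms by blast
  then interpret modular_data q1 q2 c Gs \<Gamma>s .
  show ?thesis
    unfolding V_def[symmetric] FS2_iff FS3_iff
    by (auto simp: FS_IPi FS_IK FS_IG FS_IGamma J1_def)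
qed

end
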